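(* There is an absolute constant $C>0$ such that the following holds. Let $j_1,j_2\ge0$ be integers and let $f,g\in\mathscr{S}'(\mathbb{R}^2)$ with $\operatorname{supp}f\subset A_{j_1}$, $\operatorname{supp}g\subset A_{j_2}$. If $$K_1:=\inf\{|\xi_1-\xi_2|:\exists\,\tau_1,\tau_2\text{ s.t. }(\tau_1,\xi_1)\in\operatorname{supp}f,\ (\tau_2,\xi_2)\in\operatorname{supp}g\}\ge2,$$ and if for all $(\tau_1,\xi_1)\in\operatorname{supp}f$, $(\tau_2,\xi_2)\in\operatorname{supp}g$, with $\xi=\xi_1+\xi_2$, $$\xi_1\xi_2\ge0\quad\text{and}\quad\Big|1-\frac{4}{3\xi^2\xi_1\xi_2}\Big|\le\frac12,$$ then $$\big\||\xi|^{1/4}f*g\big\|_{L^2(\mathbb{R}^2)}\le C\|f\|_{\hat X^{0,\frac12,1}}\|g\|_{\hat X^{0,\frac12,1}},$$ $$\big\||\xi|^{1/2}f*g\big\|_{L^2(\mathbb{R}^2)}\le CK_1^{-1/2}\|f\|_{\hat X^{0,\frac12,1}}\|g\|_{\hat X^{0,\frac12,1}}.$$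
   Context: Points of $\mathbb{R}^2$ are written $(\tau,\xi)$; $f,g$ are functions (distributions) of $(\tau,\xi)$, $*$ is convolution on $\mathbb{R}^2$, and $|\xi|^{a}$ denotes multiplication by that function of the variable $\xi$ of $f*g$. $\langle x\rangle=1+|x|$. For integers $j,k\ge0$, $$A_j=\{(\tau,\xi):2^j\le\langle\xi\rangle<2^{j+1}\},\qquad B_k=\{(\tau,\xi):2^k\le\langle\tau-\xi^3+\tfrac1\xi\rangle<2^{k+1}\},$$ $$\|f\|_{\hat X^{s,b,1}}=\Big[\sum_{j\ge0}\Big(\sum_{k\ge0}\big\|\langle\xi\rangle^s\langle\tau-\xi^3+\tfrac1\xi\rangle^bf\big\|_{L^2_{\tau\xi}(A_j\cap B_k)}\Big)^2\Big]^{1/2}.$$ The estimates are understood for $f,g$ for which the right-hand sides are finite. The condition on $1-\frac{4}{3\xi^2\xi_1\xi_2}$ is imposed at points where this expression is defined. *)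

theory Defs
  imports "HOL-Analysis.Analysis"
begin

section \<open>Tempered distributions on the plane\<close>

text \<open>Points of the plane are pairs \<open>(\<tau>, \<xi>)\<close>. The library has no Schwartz space, so the
  standard notions are set up here.\<close>

type_synonym plane = "real \<times> real"

definition partial_deriv :: "plane \<Rightarrow> (plane \<Rightarrow> complex) \<Rightarrow> plane \<Rightarrow> complex"
  where "partial_deriv v \<phi> p = frechet_derivative \<phi> (at p) v"

text \<open>Iterated partial derivatives are indexed by words over the two coordinate directions
  \<open>(1, 0)\<close> and \<open>(0, 1)\<close>, which form the set \<^const>\<open>Basis\<close>.\<close>

definition iter_deriv :: "plane list \<Rightarrow> (plane \<Rightarrow> complex) \<Rightarrow> plane \<Rightarrow> complex"
  where "iter_deriv vs \<phi> = foldr partial_deriv vs \<phi>"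

definition smooth :: "(plane \<Rightarrow> complex) \<Rightarrow> bool"
  where "smooth \<phi> \<longleftrightarrow> (\<forall>vs\<in>lists Basis. iter_deriv vs \<phi> differentiable_on UNIV)"

definition schwartz_space :: "(plane \<Rightarrow> complex) set"
  where "schwartz_space = {\<phi>. smooth \<phi> \<and>
    (\<forall>vs\<in>lists Basis. \<forall>N::nat. bounded (range (\<lambda>p. (1 + norm p) ^ N *\<^sub>R iter_deriv vs \<phi> p)))}"

definition schwartz_norm :: "nat \<Rightarrow> (plane \<Rightarrow> complex) \<Rightarrow> real"
  where "schwartz_norm N \<phi> =
    (\<Sum>vs | set vs \<subseteq> Basis \<and> length vs \<le> N. SUP p. (1 + norm p) ^ N * norm (iter_deriv vs \<phi> p))"

text \<open>Continuity of a linear functional on the Schwartz space means that it is bounded by one of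
  the increasing norms generating the topology. Only the values on \<^const>\<open>schwartz_space\<close>
  matter.\<close>

definition tempered_distribution :: "((plane \<Rightarrow> complex) \<Rightarrow> complex) \<Rightarrow> bool"
  where "tempered_distribution u \<longleftrightarrow>
    (\<forall>\<phi>\<in>schwartz_space. \<forall>\<psi>\<in>schwartz_space. u (\<lambda>p. \<phi> p + \<psi> p) = u \<phi> + u \<psi>) \<and>
    (\<forall>\<phi>\<in>schwartz_space. \<forall>c. u (\<lambda>p. c * \<phi> p) = c * u \<phi>) \<and>
    (\<exists>C N. \<forall>\<phi>\<in>schwartz_space. norm (u \<phi>) \<le> C * schwartz_norm N \<phi>)"

definition test_functions_on :: "plane set \<Rightarrow> (plane \<Rightarrow> complex) set"
  where "test_functions_on U =
    {\<phi>. smooth \<phi> \<and> compact (closure {p. \<phi> p \<noteq> 0}) \<and> closure {p. \<phi> p \<noteq> 0} \<subseteq> U}"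

definition dist_support :: "((plane \<Rightarrow> complex) \<Rightarrow> complex) \<Rightarrow> plane set"
  where "dist_support u = - \<Union>{U. open U \<and> (\<forall>\<phi>\<in>test_functions_on U. u \<phi> = 0)}"

definition represented_by :: "((plane \<Rightarrow> complex) \<Rightarrow> complex) \<Rightarrow> (plane \<Rightarrow> complex) \<Rightarrow> bool"
  where "represented_by u F \<longleftrightarrow> F \<in> borel_measurable lborel \<and>
    (\<forall>\<phi>\<in>schwartz_space. integrable lborel (\<lambda>p. F p * \<phi> p) \<and> u \<phi> = (\<integral>p. F p * \<phi> p \<partial>lborel))"

text \<open>A representing function is determined almost everywhere, so the choice below affects neither
  \<open>L\<^sup>2\<close> norms nor convolutions.\<close>

definition dist_fun :: "((plane \<Rightarrow> complex) \<Rightarrow> complex) \<Rightarrow> plane \<Rightarrow> complex"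
  where "dist_fun u = (SOME F. represented_by u F)"


section \<open>Norms\<close>

definition ennreal_sqrt :: "ennreal \<Rightarrow> ennreal"
  where "ennreal_sqrt x = (if x = \<infinity> then \<infinity> else ennreal (sqrt (enn2real x)))"

definition L2_norm_on :: "plane set \<Rightarrow> (plane \<Rightarrow> complex) \<Rightarrow> ennreal"
  where "L2_norm_on S F = ennreal_sqrt (\<integral>\<^sup>+p\<in>S. ennreal ((norm (F p))\<^sup>2) \<partial>lborel)"

definition bracket :: "real \<Rightarrow> real"
  where "bracket x = 1 + \<bar>x\<bar>"

text \<open>The null line \<open>\<xi> = 0\<close>, where the modulation is undefined, plays no role in the norms.\<close>

definition modulation :: "plane \<Rightarrow> real"
  where "modulation = (\<lambda>(\<tau>, \<xi>). bracket (\<tau> - \<xi> ^ 3 + 1 / \<xi>))"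

definition A_set :: "nat \<Rightarrow> plane set"
  where "A_set j = {(\<tau>, \<xi>). 2 ^ j \<le> bracket \<xi> \<and> bracket \<xi> < 2 ^ (j + 1)}"

definition B_set :: "nat \<Rightarrow> plane set"
  where "B_set k = {p. 2 ^ k \<le> modulation p \<and> modulation p < 2 ^ (k + 1)}"

definition X_hat_norm_fun :: "real \<Rightarrow> real \<Rightarrow> (plane \<Rightarrow> complex) \<Rightarrow> ennreal"
  where "X_hat_norm_fun s b F = ennreal_sqrt (\<Sum>j. (\<Sum>k. L2_norm_on (A_set j \<inter> B_set k)
    (\<lambda>p. complex_of_real (bracket (snd p) powr s * modulation p powr b) * F p))\<^sup>2)"

text \<open>The norm is infinite for distributions that are not functions.\<close>

definition X_hat_norm :: "real \<Rightarrow> real \<Rightarrow> ((plane \<Rightarrow> complex) \<Rightarrow> complex) \<Rightarrow> ennreal"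
  where "X_hat_norm s b u =
    (if \<exists>F. represented_by u F then X_hat_norm_fun s b (dist_fun u) else \<infinity>)"


section \<open>The bilinear expressions\<close>

text \<open>Distributions with finite \<open>X_hat_norm 0 (1/2)\<close> are \<open>L\<^sup>2\<close> functions, so that
  the integral below converges absolutely at every point.\<close>

definition convol :: "((plane \<Rightarrow> complex) \<Rightarrow> complex) \<Rightarrow> ((plane \<Rightarrow> complex) \<Rightarrow> complex) \<Rightarrow> plane \<Rightarrow> complex"
  where "convol f g p = (\<integral>q. dist_fun f q * dist_fun g (p - q) \<partial>lborel)"

definition weighted_convol_norm ::
    "real \<Rightarrow> ((plane \<Rightarrow> complex) \<Rightarrow> complex) \<Rightarrow> ((plane \<Rightarrow> complex) \<Rightarrow> complex) \<Rightarrow> ennreal"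
  where "weighted_convol_norm a f g =
    L2_norm_on UNIV (\<lambda>p. complex_of_real (\<bar>snd p\<bar> powr a) * convol f g p)"

text \<open>Taken in \<^typ>\<open>ennreal\<close>, so that the infimum is \<open>\<infinity>\<close> if one of the supports is empty.\<close>

definition freq_separation ::
    "((plane \<Rightarrow> complex) \<Rightarrow> complex) \<Rightarrow> ((plane \<Rightarrow> complex) \<Rightarrow> complex) \<Rightarrow> ennreal"
  where "freq_separation f g = Inf {ennreal \<bar>\<xi>1 - \<xi>2\<bar> | \<xi>1 \<xi>2.
    \<exists>\<tau>1 \<tau>2. (\<tau>1, \<xi>1) \<in> dist_support f \<and> (\<tau>2, \<xi>2) \<in> dist_support g}"

end

theory Submission
  imports Defs
begin

text \<open>The proof is a bilinear \<open>L\<^sup>2\<close> estimate by Cauchy-Schwarz and a measure bound. Split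
  both factors into pieces whose modulations have size \<open>2 ^ k1\<close> and \<open>2 ^ k2\<close>. At
  \<open>p = (\<tau>, \<xi>)\<close> the square of the convolution of two such pieces is at most the measure of the
  set of interacting points times the convolution of the squares, and the latter integrates to the
  product of the squared \<open>L\<^sup>2\<close> norms. It therefore suffices that the interaction set has measure
  at most a constant times \<open>2 ^ (k1 + k2) / (\<bar>\<xi>\<bar> K)\<close>, where \<open>K\<close> is the frequency separation;
  this is the lemma \<open>interaction_set_cover\<close>. By Minkowski's inequality the pieces are summed over
  \<open>k1\<close> and \<open>k2\<close> with weights \<open>2 ^ (k1 / 2)\<close> and \<open>2 ^ (k2 / 2)\<close>, which is the summation built into
  the norms.

  The measure bound rests on the resonance function. The two modulations add up, apart from a term
  depending on \<open>\<tau>\<close> and \<open>\<xi>\<close> only, to \<open>h = 3 \<xi> x + \<xi> / x\<close> with \<open>x = \<xi>1 \<xi>2\<close>, so that \<open>h\<close>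
  is confined to an interval of length comparable to \<open>2 ^ max k1 k2\<close>. The hypothesis
  \<open>\<bar>1 - 4 / (3 \<xi>\<^sup>2 x)\<bar> \<le> 1 / 2\<close> together with \<open>\<bar>\<xi>1 - \<xi>2\<bar> \<ge> 2\<close> forces \<open>0 < x < 1 / 2\<close>
  off the null lines \<open>\<xi>1 = 0\<close> and \<open>\<xi>2 = 0\<close>.
  There the singular term \<open>\<xi> / x\<close> dominates, and on each side of \<open>\<xi>1 = \<xi>2\<close> the map from
  \<open>\<xi>1\<close> to \<open>h\<close> expands distances by at least \<open>\<bar>\<xi>\<bar> K\<close> (\<open>resonance_expanding\<close>). Hence \<open>\<xi>1\<close>
  is confined to two short intervals, while for given \<open>\<xi>1\<close> the smaller of the two modulations
  confines the time frequency.

  The estimate with the weight \<open>\<bar>\<xi>\<bar> powr (1/4)\<close> follows from the one with \<open>\<bar>\<xi>\<bar> powr (1/2)\<close>: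
  frequencies of equal sign at distance at least 2 have a sum of size at least 2.

  The hypotheses concern supports of distributions, whereas the estimate concerns representing
  functions. The two are linked by the fact that a representing function vanishes almost everywhere
  off the support (\<open>represented_by_AE_eq_0_off_support\<close>), which requires a supply of test functions:
  smooth bumps that approximate the indicator functions of boxes.\<close>

section \<open>Smooth bump functions\<close>

text \<open>Counting derivatives, instead of asking for all of them at once, allows closure under products
  to be proved by induction without the Leibniz formula.\<close>

fun times_differentiable :: "nat \<Rightarrow> (real \<Rightarrow> real) \<Rightarrow> bool" where
  "times_differentiable 0 u \<longleftrightarrow> True"
| "times_differentiable (Suc n) u \<longleftrightarrow>
     (\<exists>u'. (\<forall>x. (u has_real_derivative u' x) (at x)) \<and> times_differentiable n u')"

definition smooth_real :: "(real \<Rightarrow> real) \<Rightarrow> bool"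
  where "smooth_real u \<longleftrightarrow> (\<forall>n. times_differentiable n u)"

lemma times_differentiable_SucI:
  "(\<And>x. (u has_real_derivative u' x) (at x)) \<Longrightarrow> times_differentiable n u' \<Longrightarrow>
    times_differentiable (Suc n) u"
  by (simp only: times_differentiable.simps) blast

lemma times_differentiable_Suc_D:
  "times_differentiable (Suc n) u \<Longrightarrow> times_differentiable n u"
  by (induction n arbitrary: u) (simp, metis times_differentiable.simps(2))

lemma times_differentiable_lin:
  "times_differentiable n u \<Longrightarrow> times_differentiable n v \<Longrightarrow>
    times_differentiable n (\<lambda>x. a * u x + b * v x)"
proof (induction n arbitrary: u v)
  case (Suc n)
  then obtain u' v' where
    "\<And>x. (u has_real_derivative u' x) (at x)" "times_differentiable n u'"
    "\<And>x. (v has_real_derivative v' x) (at x)" "times_differentiable n v'"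
    by auto
  then have "times_differentiable n (\<lambda>x. a * u' x + b * v' x)"
    and "((\<lambda>x. a * u x + b * v x) has_real_derivative a * u' x + b * v' x) (at x)" for x
    by (auto intro!: Suc.IH DERIV_add DERIV_cmult)
  then show ?case by (rule times_differentiable_SucI[rotated])
qed simp

lemma times_differentiable_mult:
  "times_differentiable n u \<Longrightarrow> times_differentiable n v \<Longrightarrow>
    times_differentiable n (\<lambda>x. u x * v x)"
proof (induction n arbitrary: u v)
  case (Suc n)
  then obtain u' v' where
    D: "\<And>x. (u has_real_derivative u' x) (at x)" "times_differentiable n u'"
    "\<And>x. (v has_real_derivative v' x) (at x)" "times_differentiable n v'"
    by auto
  have "times_differentiable n (\<lambda>x. 1 * (u' x * v x) + 1 * (u x * v' x))"
    using D Suc.prems[THEN times_differentiable_Suc_D] by (intro times_differentiable_lin Suc.IH)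
  then have "times_differentiable n (\<lambda>x. u' x * v x + u x * v' x)" by simp
  moreover have "((\<lambda>x. u x * v x) has_real_derivative u' x * v x + u x * v' x) (at x)" for x
    using DERIV_mult[OF D(1,3)] by (simp add: mult.commute)
  ultimately show ?case by (rule times_differentiable_SucI[rotated])
qed simp

lemma times_differentiable_affine:
  "times_differentiable n u \<Longrightarrow> times_differentiable n (\<lambda>x. u (k * x + c))"
proof (induction n arbitrary: u)
  case (Suc n)
  then obtain u' where
    D: "\<And>x. (u has_real_derivative u' x) (at x)" "times_differentiable n u'" by auto
  have "times_differentiable n (\<lambda>x. k * u' (k * x + c) + 0 * u' (k * x + c))"
    by (intro times_differentiable_lin Suc.IH D)
  then have "times_differentiable n (\<lambda>x. u' (k * x + c) * k)" by (simp add: mult.commute)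
  moreover have "((\<lambda>x. u (k * x + c)) has_real_derivative u' (k * x + c) * k) (at x)" for x
    by (rule DERIV_chain2[OF D(1)]) (auto intro!: derivative_eq_intros)
  ultimately show ?case by (rule times_differentiable_SucI[rotated])
qed simp

text \<open>The family \<open>x\<^sup>-\<^sup>m exp (- 1 / x)\<close> spans a space that is closed under differentiation, so
  smoothness at the origin follows by one induction over the number of derivatives.\<close>

definition exp_cutoff :: "nat \<Rightarrow> real \<Rightarrow> real"
  where "exp_cutoff m x = (if x > 0 then (1 / x) ^ m * exp (- (1 / x)) else 0)"

lemma exp_cutoff_tendsto_0: "(exp_cutoff m \<longlongrightarrow> 0) (at 0)"
proof (rule filterlim_split_at)
  have "((\<lambda>x::real. (1 / x) ^ m / exp (1 / x)) \<longlongrightarrow> 0) (at_right 0)"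
    using filterlim_compose[OF tendsto_power_div_exp_0, of "\<lambda>x. inverse x" "at_right 0" m]
      filterlim_inverse_at_top_right by (simp add: inverse_eq_divide)
  then show "(exp_cutoff m \<longlongrightarrow> 0) (at_right 0)"
    by (rule Lim_transform_eventually)
      (auto simp: eventually_at_right_less exp_cutoff_def exp_minus field_simps intro!: eventually_at_rightI[of 0 1])
  show "(exp_cutoff m \<longlongrightarrow> 0) (at_left 0)"
    by (rule Lim_transform_eventually[OF tendsto_const])
      (auto simp: exp_cutoff_def intro!: eventually_at_leftI[of "-1"])
qed

lemma exp_cutoff_has_derivative:
  "(exp_cutoff m has_real_derivative 1 * exp_cutoff (m + 2) x + (- real m) * exp_cutoff (m + 1) x) (at x)"
proof -
  consider "x < 0" | "x = 0" | "x > 0" by linarith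
  then show ?thesis
  proof cases
    case 1
    have "((\<lambda>_. 0) has_real_derivative 0) (at x)" by simp
    then have "(exp_cutoff m has_real_derivative 0) (at x)"
      by (rule has_field_derivative_transform_within_open[of _ _ _ "{..<0}"])
        (use 1 in \<open>auto simp: exp_cutoff_def\<close>)
    then show ?thesis using 1 by (simp add: exp_cutoff_def)
  next
    case 2
    have "exp_cutoff m h / h = exp_cutoff (m + 1) h" for h
      by (simp add: exp_cutoff_def)
    then have "(exp_cutoff m has_real_derivative 0) (at 0)"
      using exp_cutoff_tendsto_0[of "m + 1"]
      by (simp add: DERIV_def exp_cutoff_def[of m 0])
    then show ?thesis using 2 by (simp add: exp_cutoff_def)
  next
    case 3
    have "((\<lambda>x. (1 / x) ^ m * exp (- (1 / x))) has_real_derivative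
        1 * exp_cutoff (m + 2) x + (- real m) * exp_cutoff (m + 1) x) (at x)"
    proof -
      have inv: "((\<lambda>x. 1 / x) has_real_derivative - ((1 / x)\<^sup>2)) (at x)"
        using 3 by (auto intro!: derivative_eq_intros simp: power2_eq_square)
      have "((\<lambda>x. (1 / x) ^ m * exp (- (1 / x))) has_real_derivative
          (real m * (- ((1 / x)\<^sup>2) * (1 / x) ^ (m - Suc 0))) * exp (- (1 / x))
          + (exp (- (1 / x)) * - (- ((1 / x)\<^sup>2))) * (1 / x) ^ m) (at x)"
        by (intro DERIV_mult DERIV_power DERIV_chain2[OF DERIV_exp] DERIV_minus inv)
      moreover have "real m * (- ((1 / x)\<^sup>2) * (1 / x) ^ (m - Suc 0)) = - (real m * (1 / x) ^ (m + 1))"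
        by (cases m) (simp_all add: power2_eq_square)
      moreover have "(exp (- (1 / x)) * - (- ((1 / x)\<^sup>2))) * (1 / x) ^ m = (1 / x) ^ (m + 2) * exp (- (1 / x))"
        by (simp only: power_add) (simp add: algebra_simps)
      ultimately show ?thesis using 3
        by (simp only: exp_cutoff_def if_True) (simp add: mult_ac)
    qed
    then show ?thesis
      by (rule has_field_derivative_transform_within_open[of _ _ _ "{0<..}"])
        (use 3 in \<open>auto simp: exp_cutoff_def\<close>)
  qed
qed

lemma smooth_exp_cutoff: "smooth_real (exp_cutoff m)"
proof -
  have "times_differentiable n (exp_cutoff m)" for n
  proof (induction n arbitrary: m)
    case (Suc n)
    show ?case
      by (rule times_differentiable_SucI[OF exp_cutoff_has_derivative times_differentiable_lin[OF Suc.IH Suc.IH]])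
  qed simp
  then show ?thesis by (simp add: smooth_real_def)
qed

text \<open>The witness may be chosen independently of the number of derivatives, because derivatives are
  unique.\<close>

lemma smooth_real_derivative:
  assumes "smooth_real u"
  obtains u' where "smooth_real u'" "\<And>x. (u has_real_derivative u' x) (at x)"
proof
  have D: "(u has_real_derivative deriv u x) (at x)" for x
    using assms[unfolded smooth_real_def, rule_format, of "Suc 0"]
    by (metis DERIV_imp_deriv times_differentiable.simps(2))
  show "(u has_real_derivative deriv u x) (at x)" for x by (rule D)
  show "smooth_real (deriv u)"
    unfolding smooth_real_def
  proof
    fix n
    obtain u' where u': "\<And>x. (u has_real_derivative u' x) (at x)" "times_differentiable n u'"
      using assms[unfolded smooth_real_def, rule_format, of "Suc n"] by auto
    then have "deriv u = u'" by (auto intro: DERIV_imp_deriv)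
    then show "times_differentiable n (deriv u)" using u' by simp
  qed
qed

text \<open>For fixed \<open>k > 0\<close> this is a bump supported in \<open>[a, b]\<close>; as \<open>k\<close> grows, both factors
  increase to 1 inside the interval.\<close>

definition bump :: "real \<Rightarrow> real \<Rightarrow> real \<Rightarrow> real \<Rightarrow> real"
  where "bump k a b x = exp_cutoff 0 (k * x + - (k * a)) * exp_cutoff 0 (- k * x + k * b)"

lemma smooth_bump: "smooth_real (bump k a b)"
  using smooth_exp_cutoff[of 0] unfolding smooth_real_def bump_def[abs_def]
  by (intro allI times_differentiable_mult times_differentiable_affine) auto

lemma bump_bounds: "0 \<le> bump k a b x" "bump k a b x \<le> 1"
  by (auto simp: bump_def exp_cutoff_def mult_le_one)

lemma bump_pos_iff: "k > 0 \<Longrightarrow> bump k a b x > 0 \<longleftrightarrow> a < x \<and> x < b"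
  by (auto simp: bump_def exp_cutoff_def zero_less_mult_iff)

lemma bump_eq_0: "k > 0 \<Longrightarrow> \<not> (a < x \<and> x < b) \<Longrightarrow> bump k a b x = 0"
  using bump_pos_iff[of k a b x] bump_bounds(1)[of k a b x] by linarith

lemma bump_tendsto_indicator:
  "(\<lambda>n. bump (real (Suc n)) a b x) \<longlonglongrightarrow> indicator {a<..<b} x"
proof (cases "a < x \<and> x < b")
  case True
  have pos: "real (Suc n) * x + - (real (Suc n) * a) > 0" "- real (Suc n) * x + real (Suc n) * b > 0" for n
    using mult_strict_left_mono[of a x "real (Suc n)"] mult_strict_left_mono[of x b "real (Suc n)"] True
    by linarith+
  have lim: "(\<lambda>n. exp (- (1 / (real (Suc n) * c)))) \<longlonglongrightarrow> 1" if "c > 0" for c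
  proof -
    have "(\<lambda>n. 1 / real (Suc n) * (1 / c)) \<longlonglongrightarrow> 0 * (1 / c)"
      using LIMSEQ_inverse_real_of_nat by (intro tendsto_mult tendsto_const) (simp add: inverse_eq_divide)
    then have "(\<lambda>n. exp (- (1 / real (Suc n) * (1 / c)))) \<longlonglongrightarrow> exp (- 0)"
      by (intro tendsto_intros) simp
    then show ?thesis by simp
  qed
  have "bump (real (Suc n)) a b x =
      exp (- (1 / (real (Suc n) * (x - a)))) * exp (- (1 / (real (Suc n) * (b - x))))" for n
    using pos[of n] by (simp add: bump_def exp_cutoff_def algebra_simps)
  moreover have "(\<lambda>n. exp (- (1 / (real (Suc n) * (x - a)))) * exp (- (1 / (real (Suc n) * (b - x)))))
      \<longlonglongrightarrow> 1 * 1"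
    using True by (intro tendsto_mult lim) auto
  ultimately show ?thesis using True by simp
next
  case False
  then show ?thesis by (simp add: bump_eq_0)
qed

text \<open>Tensor products are closed under both partial derivatives and keep their compact support. This
  reduces smoothness on the plane to calculus in one variable.\<close>

definition smooth_products :: "real \<Rightarrow> real \<Rightarrow> real \<Rightarrow> real \<Rightarrow> (plane \<Rightarrow> complex) set"
  where "smooth_products a b c d =
    {\<lambda>p. complex_of_real (u (fst p) * v (snd p)) | u v. smooth_real u \<and> smooth_real v \<and>
       (\<forall>x. x \<notin> {a..b} \<longrightarrow> u x = 0) \<and> (\<forall>x. x \<notin> {c..d} \<longrightarrow> v x = 0)}"

lemma smooth_productsI:
  assumes "smooth_real u" "smooth_real v"
    "\<And>x. x \<notin> {a..b} \<Longrightarrow> u x = 0" "\<And>x. x \<notin> {c..d} \<Longrightarrow> v x = 0"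
  shows "(\<lambda>p. complex_of_real (u (fst p) * v (snd p))) \<in> smooth_products a b c d"
  unfolding smooth_products_def using assms by blast

lemma derivative_vanishes_outside:
  assumes D: "\<And>x. (u has_real_derivative u' x) (at x)" and 0: "\<And>x. x \<notin> {a..b} \<Longrightarrow> u x = 0"
    and x: "x \<notin> {a..b}"
  shows "u' x = 0"
proof -
  have "((\<lambda>_. 0) has_real_derivative 0) (at x)" by simp
  then have "(u has_real_derivative 0) (at x)"
    by (rule has_field_derivative_transform_within_open[of _ _ _ "- {a..b}"])
      (use x 0 in auto)
  then show ?thesis using D DERIV_unique by blast
qed

lemma smooth_products_derivative:
  assumes "\<phi> \<in> smooth_products a b c d"
  shows "\<phi> differentiable_on UNIV"
    and "v \<in> Basis \<Longrightarrow> partial_deriv v \<phi> \<in> smooth_products a b c d"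
proof -
  obtain u w where \<phi>: "\<phi> = (\<lambda>p. complex_of_real (u (fst p) * w (snd p)))"
    and sm: "smooth_real u" "smooth_real w"
    and z: "\<And>x. x \<notin> {a..b} \<Longrightarrow> u x = 0" "\<And>x. x \<notin> {c..d} \<Longrightarrow> w x = 0"
    using assms unfolding smooth_products_def by blast
  obtain u' where u': "smooth_real u'" "\<And>x. (u has_real_derivative u' x) (at x)"
    using smooth_real_derivative[OF sm(1)] by blast
  obtain w' where w': "smooth_real w'" "\<And>x. (w has_real_derivative w' x) (at x)"
    using smooth_real_derivative[OF sm(2)] by blast
  have u'0: "u' x = 0" if "x \<notin> {a..b}" for x
    by (rule derivative_vanishes_outside[where u = u]) (rule u'(2), erule z(1), rule that)
  have w'0: "w' x = 0" if "x \<notin> {c..d}" for x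
    by (rule derivative_vanishes_outside[where u = w]) (rule w'(2), erule z(2), rule that)
  have D: "(\<phi> has_derivative
     (\<lambda>h. complex_of_real (u (fst p) * (w' (snd p) * snd h) + (u' (fst p) * fst h) * w (snd p)))) (at p)" for p
  proof -
    have 1: "((\<lambda>p. u (fst p)) has_derivative (\<lambda>h. u' (fst p) * fst h)) (at p)"
      using has_derivative_compose[OF has_derivative_fst[OF has_derivative_ident] u'(2)[of "fst p", unfolded has_field_derivative_def]]
      by simp
    have 2: "((\<lambda>p. w (snd p)) has_derivative (\<lambda>h. w' (snd p) * snd h)) (at p)"
      using has_derivative_compose[OF has_derivative_snd[OF has_derivative_ident] w'(2)[of "snd p", unfolded has_field_derivative_def]]
      by simp
    show ?thesis unfolding \<phi> by (intro has_derivative_of_real has_derivative_mult 1 2)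
  qed
  then show "\<phi> differentiable_on UNIV"
    unfolding differentiable_on_def differentiable_def by (blast intro: has_derivative_at_withinI)
  have P: "partial_deriv v \<phi> = (\<lambda>p. complex_of_real (u (fst p) * (w' (snd p) * snd v) + (u' (fst p) * fst v) * w (snd p)))" for v
    unfolding partial_deriv_def frechet_derivative_at[OF D, symmetric] ..
  assume "v \<in> Basis"
  then have "v = (1, 0) \<or> v = (0, 1)" by (auto simp: Basis_prod_def)
  then show "partial_deriv v \<phi> \<in> smooth_products a b c d"
  proof
    assume "v = (1, 0)"
    then have "partial_deriv v \<phi> = (\<lambda>p. complex_of_real (u' (fst p) * w (snd p)))"
      unfolding P by simp
    then show ?thesis
      by (rule ssubst) (intro smooth_productsI u'(1) sm(2) u'0 z(2))
  next
    assume "v = (0, 1)"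
    then have "partial_deriv v \<phi> = (\<lambda>p. complex_of_real (u (fst p) * w' (snd p)))"
      unfolding P by simp
    then show ?thesis
      by (rule ssubst) (intro smooth_productsI sm(1) w'(1) z(1) w'0)
  qed
qed

lemma iter_deriv_smooth_products:
  "\<phi> \<in> smooth_products a b c d \<Longrightarrow> vs \<in> lists Basis \<Longrightarrow> iter_deriv vs \<phi> \<in> smooth_products a b c d"
proof (induction vs)
  case (Cons v vs)
  then have "partial_deriv v (iter_deriv vs \<phi>) \<in> smooth_products a b c d"
    by (intro smooth_products_derivative(2)) auto
  then show ?case by (simp add: iter_deriv_def)
qed (simp add: iter_deriv_def)

lemma smooth_products_support:
  assumes "\<phi> \<in> smooth_products a b c d" "p \<notin> {a..b} \<times> {c..d}"
  shows "\<phi> p = 0"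
proof -
  obtain u v where "\<phi> = (\<lambda>p. complex_of_real (u (fst p) * v (snd p)))"
    and "\<And>x. x \<notin> {a..b} \<Longrightarrow> u x = 0" "\<And>x. x \<notin> {c..d} \<Longrightarrow> v x = 0"
    using assms(1) unfolding smooth_products_def by blast
  moreover have "fst p \<notin> {a..b} \<or> snd p \<notin> {c..d}"
    using assms(2) by (simp only: mem_Times_iff) blast
  ultimately show ?thesis by (elim disjE) (simp_all del: atLeastAtMost_iff)
qed

lemma smooth_products_test_function:
  assumes \<phi>: "\<phi> \<in> smooth_products a b c d"
  shows "\<phi> \<in> schwartz_space" "{a..b} \<times> {c..d} \<subseteq> U \<Longrightarrow> \<phi> \<in> test_functions_on U"
proof -
  have sm: "smooth \<phi>"
    unfolding smooth_def
  proof
    fix vs :: "plane list" assume "vs \<in> lists Basis"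
    from iter_deriv_smooth_products[OF \<phi> this]
    show "iter_deriv vs \<phi> differentiable_on UNIV" by (rule smooth_products_derivative(1))
  qed
  have "bounded (range (\<lambda>p. (1 + norm p) ^ N *\<^sub>R \<psi> p))" if \<psi>: "\<psi> \<in> smooth_products a b c d" for \<psi> N
  proof -
    let ?h = "\<lambda>p. (1 + norm p) ^ N *\<^sub>R \<psi> p" and ?K = "{a..b} \<times> {c..d}"
    have "continuous_on ?K \<psi>"
      using differentiable_imp_continuous_on[OF smooth_products_derivative(1)[OF \<psi>]]
      by (rule continuous_on_subset) simp
    then have "continuous_on ?K ?h"
      by (intro continuous_intros)
    then have "bounded (?h ` ?K)"
      by (intro compact_imp_bounded compact_continuous_image compact_Times) auto
    moreover have "range ?h \<subseteq> insert 0 (?h ` ?K)"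
    proof safe
      fix p assume "?h p \<notin> ?h ` ?K"
      then have "p \<notin> ?K" by blast
      then show "?h p = 0" using smooth_products_support[OF \<psi>] by simp
    qed
    ultimately show ?thesis by (meson bounded_insert bounded_subset)
  qed
  with sm show "\<phi> \<in> schwartz_space"
    unfolding schwartz_space_def by (simp add: iter_deriv_smooth_products[OF \<phi>])
  have "closure {p. \<phi> p \<noteq> 0} \<subseteq> {a..b} \<times> {c..d}"
    using smooth_products_support[OF \<phi>] by (intro closure_minimal closed_Times) auto
  moreover from this have "compact (closure {p. \<phi> p \<noteq> 0})"
    by (metis compact_Times compact_Icc compact_Int_closed closed_closure inf.absorb2)
  ultimately show "{a..b} \<times> {c..d} \<subseteq> U \<Longrightarrow> \<phi> \<in> test_functions_on U"
    unfolding test_functions_on_def using sm by auto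
qed

definition box_bump :: "real \<Rightarrow> real \<Rightarrow> real \<Rightarrow> real \<Rightarrow> real \<Rightarrow> plane \<Rightarrow> complex"
  where "box_bump k a b c d p = complex_of_real (bump k a b (fst p) * bump k c d (snd p))"

lemma box_bump_in_smooth_products:
  assumes "k > 0" shows "box_bump k a b c d \<in> smooth_products a b c d"
  unfolding box_bump_def[abs_def]
  by (intro smooth_productsI smooth_bump bump_eq_0 assms) auto

section \<open>A function vanishes almost everywhere off the support of its distribution\<close>

lemma cbox_plane: "cbox l r = {fst l..fst r} \<times> {snd l..snd r}" for l r :: plane
  by (simp add: cbox_prod)

lemma box_bump_bounds: "norm (box_bump k a b c d p) \<le> 1"
  using mult_le_one[OF bump_bounds(2)[of k a b "fst p"] bump_bounds(1,2)[of k c d "snd p"]]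
    bump_bounds(1)[of k a b "fst p"] bump_bounds(1)[of k c d "snd p"]
  unfolding box_bump_def norm_of_real by (simp add: abs_mult)

lemma bump_lower_bound:
  assumes "x \<in> {a..b}" shows "bump 1 (a - 1) (b + 1) x \<ge> exp (-2)"
proof -
  have E: "exp_cutoff 0 y \<ge> exp (-1)" if "y \<ge> 1" for y
    using that by (simp add: exp_cutoff_def)
  have "exp (-1) * exp (-1) \<le> bump 1 (a - 1) (b + 1) x"
    unfolding bump_def by (rule mult_mono) (use assms in \<open>auto intro!: E simp: exp_cutoff_def\<close>)
  then show ?thesis by (simp flip: exp_add)
qed

text \<open>The pairing of \<open>F\<close> with a Schwartz function that is bounded below on the box is absolutely
  integrable, hence so is \<open>F\<close> on the box. The bump of the box enlarged by 1 on every side serves.\<close>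

lemma represented_by_locally_integrable:
  assumes "represented_by u F"
  shows "set_integrable lborel (cbox l r) F"
proof -
  define \<phi> where "\<phi> = box_bump 1 (fst l - 1) (fst r + 1) (snd l - 1) (snd r + 1)"
  have "\<phi> \<in> schwartz_space"
    unfolding \<phi>_def by (intro smooth_products_test_function(1)[OF box_bump_in_smooth_products]) simp
  then have int: "integrable lborel (\<lambda>p. F p * \<phi> p)" and F: "F \<in> borel_measurable lborel"
    using assms unfolding represented_by_def by auto
  have lower: "norm (\<phi> p) \<ge> exp (-4)" if "p \<in> cbox l r" for p
  proof -
    have "exp (-2) * exp (-2) \<le>
        bump 1 (fst l - 1) (fst r + 1) (fst p) * bump 1 (snd l - 1) (snd r + 1) (snd p)"
      using that by (intro mult_mono bump_lower_bound bump_bounds) (auto simp: cbox_plane)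
    then show ?thesis unfolding \<phi>_def box_bump_def norm_of_real by (simp flip: exp_add)
  qed
  have "integrable lborel (\<lambda>p. exp 4 *\<^sub>R (F p * \<phi> p))"
    by (intro integrable_scaleR_right int)
  then show ?thesis
    unfolding set_integrable_def
  proof (rule Bochner_Integration.integrable_bound)
    show "(\<lambda>p. indicat_real (cbox l r) p *\<^sub>R F p) \<in> borel_measurable lborel"
      using F by measurable
    show "AE p in lborel. norm (indicat_real (cbox l r) p *\<^sub>R F p) \<le> norm (exp 4 *\<^sub>R (F p * \<phi> p))"
    proof (intro AE_I2)
      fix p
      show "norm (indicat_real (cbox l r) p *\<^sub>R F p) \<le> norm (exp 4 *\<^sub>R (F p * \<phi> p))"
      proof (cases "p \<in> cbox l r")
        case True
        have "norm (F p) = norm (F p) * exp 4 * exp (-4)" by (simp add: exp_minus)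
        also have "\<dots> \<le> norm (F p) * exp 4 * norm (\<phi> p)"
          using lower[OF True] by (intro mult_left_mono) auto
        finally show ?thesis using True by (simp add: norm_mult mult_ac)
      qed simp
    qed
  qed
qed

text \<open>The bumps converge boundedly to the indicator function of the open box, whose boundary is
  a null set.\<close>

lemma integral_over_box_eq_0:
  assumes rep: "represented_by u F"
    and vanish: "\<forall>\<phi>\<in>test_functions_on U. u \<phi> = 0"
    and U: "cbox l r \<subseteq> U"
  shows "integral (cbox l r) F = 0"
proof -
  define \<phi> where "\<phi> n = box_bump (real (Suc n)) (fst l) (fst r) (snd l) (snd r)" for n
  have prod: "\<phi> n \<in> smooth_products (fst l) (fst r) (snd l) (snd r)" for n
    unfolding \<phi>_def by (intro box_bump_in_smooth_products) simp
  have "\<phi> n \<in> schwartz_space" for n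
    using prod by (rule smooth_products_test_function(1))
  moreover have "\<phi> n \<in> test_functions_on U" for n
    using prod U by (intro smooth_products_test_function(2)) (auto simp: cbox_plane)
  ultimately have int: "(\<integral>p. F p * \<phi> n p \<partial>lborel) = 0" "integrable lborel (\<lambda>p. F p * \<phi> n p)" for n
    using rep vanish unfolding represented_by_def by (metis, blast)
  have supp: "\<phi> n p = 0" if "p \<notin> cbox l r" for n p
    using smooth_products_support[OF prod] that by (simp add: cbox_plane)
  have F: "F \<in> borel_measurable lborel" using rep by (simp add: represented_by_def)
  have "(\<lambda>n. \<integral>p. F p * \<phi> n p \<partial>lborel) \<longlonglongrightarrow> (\<integral>p. indicat_real (box l r) p *\<^sub>R F p \<partial>lborel)"
  proof (rule integral_dominated_convergence)
    show "(\<lambda>p. indicat_real (box l r) p *\<^sub>R F p) \<in> borel_measurable lborel" using F by measurable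
    show "(\<lambda>p. F p * \<phi> n p) \<in> borel_measurable lborel" for n
      using int(2) by (rule borel_measurable_integrable)
    show "integrable lborel (\<lambda>p. norm (indicat_real (cbox l r) p *\<^sub>R F p))"
      using represented_by_locally_integrable[OF rep, of l r] unfolding set_integrable_def
      by (rule integrable_norm)
    show "AE p in lborel. norm (F p * \<phi> n p) \<le> norm (indicat_real (cbox l r) p *\<^sub>R F p)" for n
    proof (intro AE_I2)
      fix p
      show "norm (F p * \<phi> n p) \<le> norm (indicat_real (cbox l r) p *\<^sub>R F p)"
        using supp[of p n] box_bump_bounds mult_left_mono[of "norm (\<phi> n p)" 1 "norm (F p)"]
        by (cases "p \<in> cbox l r") (auto simp: norm_mult \<phi>_def)
    qed
    show "AE p in lborel. (\<lambda>n. F p * \<phi> n p) \<longlonglongrightarrow> indicat_real (box l r) p *\<^sub>R F p"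
    proof (intro AE_I2)
      fix p
      have "(\<lambda>n. \<phi> n p) \<longlonglongrightarrow> complex_of_real
          (indicator {fst l<..<fst r} (fst p) * indicator {snd l<..<snd r} (snd p))"
        unfolding \<phi>_def box_bump_def by (intro tendsto_of_real tendsto_mult bump_tendsto_indicator)
      also have "indicator {fst l<..<fst r} (fst p) * indicator {snd l<..<snd r} (snd p) =
          indicat_real (box l r) p"
        by (cases p) (simp add: box_prod indicator_def)
      finally have "(\<lambda>n. F p * \<phi> n p) \<longlonglongrightarrow> F p * complex_of_real (indicat_real (box l r) p)"
        by (intro tendsto_mult tendsto_const)
      then show "(\<lambda>n. F p * \<phi> n p) \<longlonglongrightarrow> indicat_real (box l r) p *\<^sub>R F p"
        by (simp add: scaleR_conv_of_real mult.commute)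
    qed
  qed
  then have "(LINT p : box l r | lborel. F p) = 0"
    unfolding set_lebesgue_integral_def int(1) by (metis LIMSEQ_const_iff)
  moreover have "set_integrable lborel (box l r) F"
    by (rule set_integrable_subset[OF represented_by_locally_integrable[OF rep, of l r]])
      (auto simp: box_subset_cbox)
  ultimately show ?thesis
    using set_borel_integral_eq_integral(2) by (metis integral_open_interval)
qed

text \<open>By the Lebesgue differentiation theorem, \<open>F\<close> is almost everywhere the limit of its averages
  over small boxes.\<close>

lemma AE_eq_0_if_box_integrals_eq_0:
  fixes F :: "'a::euclidean_space \<Rightarrow> 'b::euclidean_space"
  assumes int: "set_integrable lborel (cbox l r) F"
    and zero: "\<And>a b. cbox a b \<subseteq> cbox l r \<Longrightarrow> integral (cbox a b) F = 0"
  shows "AE x in lborel. x \<in> box l r \<longrightarrow> F x = 0"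
proof -
  define G where "G x = indicat_real (cbox l r) x *\<^sub>R F x" for x
  have "G integrable_on UNIV"
    using int unfolding set_integrable_def G_def by (rule integrable_on_lborel)
  then have "G integrable_on cbox a b" for a b
    by (rule integrable_on_subcbox) simp
  then obtain N where N: "negligible N" and avg: "\<And>x e. \<lbrakk>x \<notin> N; 0 < e\<rbrakk> \<Longrightarrow>
      \<exists>d>0. \<forall>h. 0 < h \<and> h < d \<longrightarrow>
        norm (integral (cbox x (x + h *\<^sub>R One)) G /\<^sub>R h ^ DIM('a) - G x) < e"
    using integrable_ccontinuous_explicit by blast
  have "F x = 0" if x: "x \<in> box l r" "x \<notin> N" for x
  proof -
    have "norm (G x) < e" if "e > 0" for e
    proof -
      obtain d where d: "d > 0" "\<And>h. 0 < h \<Longrightarrow> h < d \<Longrightarrow>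
          norm (integral (cbox x (x + h *\<^sub>R One)) G /\<^sub>R h ^ DIM('a) - G x) < e"
        using avg[OF x(2) \<open>e > 0\<close>] by blast
      \<comment> \<open>The largest side for which the cube with lower corner \<open>x\<close> stays below \<open>r\<close>.\<close>
      define \<delta> where "\<delta> = Min ((\<lambda>i. (r - x) \<bullet> i) ` Basis)"
      have \<delta>: "\<delta> > 0" "\<And>i. i \<in> Basis \<Longrightarrow> \<delta> \<le> (r - x) \<bullet> i"
        using x(1) by (auto simp: \<delta>_def mem_box inner_diff_left)
      define h where "h = min (d / 2) \<delta>"
      have h: "0 < h" "h < d" "h \<le> \<delta>" using d(1) \<delta>(1) by (auto simp: h_def)
      have sub: "cbox x (x + h *\<^sub>R One) \<subseteq> cbox l r"
      proof
        fix y assume y: "y \<in> cbox x (x + h *\<^sub>R One)"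
        have "l \<bullet> i \<le> y \<bullet> i \<and> y \<bullet> i \<le> r \<bullet> i" if "i \<in> Basis" for i
        proof -
          have "x \<bullet> i \<le> y \<bullet> i" "y \<bullet> i \<le> x \<bullet> i + h" "l \<bullet> i < x \<bullet> i"
            using y x(1) that by (auto simp: mem_box inner_add_left)
          moreover have "h \<le> r \<bullet> i - x \<bullet> i" using h(3) \<delta>(2)[OF that] by (simp add: inner_diff_left)
          ultimately show ?thesis by linarith
        qed
        then show "y \<in> cbox l r" by (simp add: mem_box)
      qed
      have "integral (cbox x (x + h *\<^sub>R One)) G = integral (cbox x (x + h *\<^sub>R One)) F"
        using sub by (intro integral_cong) (auto simp: G_def)
      also have "\<dots> = 0" by (rule zero[OF sub])
      finally show ?thesis using d(2)[OF h(1,2)] by simp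
    qed
    then have "G x = 0" by (metis less_irrefl norm_le_zero_iff linorder_not_less)
    then show ?thesis using x(1) box_subset_cbox[of l r] by (auto simp: G_def)
  qed
  moreover have "AE x in lborel. x \<notin> N"
    using N AE_not_in[of N lebesgue] by (simp add: negligible_iff_null_sets AE_completion_iff)
  ultimately show ?thesis by (auto elim: eventually_mono)
qed

text \<open>The complement of the support is a union of open sets on which the distribution vanishes, and
  so of boxes on which \<open>F\<close> vanishes almost everywhere. By Lindelof's theorem countably many of
  these boxes suffice, so that the exceptional null sets can be united.\<close>

lemma represented_by_AE_eq_0_off_support:
  assumes rep: "represented_by u F"
  shows "AE p in lborel. p \<notin> dist_support u \<longrightarrow> F p = 0"
proof -
  define \<B> where "\<B> = {box l r | l r. AE p in lborel. p \<in> box l r \<longrightarrow> F p = 0}"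
  obtain \<B>' where \<B>': "\<B>' \<subseteq> \<B>" "countable \<B>'" "\<Union>\<B>' = \<Union>\<B>"
    by (rule Lindelof[of \<B>]) (auto simp: \<B>_def)
  have "AE p in lborel. \<forall>B\<in>\<B>'. p \<in> B \<longrightarrow> F p = 0"
    using \<B>'(1) by (subst AE_ball_countable[OF \<B>'(2)]) (auto simp: \<B>_def)
  moreover have "- dist_support u \<subseteq> \<Union>\<B>"
  proof
    fix p assume "p \<in> - dist_support u"
    then obtain U where U: "open U" "\<forall>\<phi>\<in>test_functions_on U. u \<phi> = 0" "p \<in> U"
      unfolding dist_support_def by auto
    obtain l r where lr: "cbox l r \<subseteq> U" "p \<in> box l r"
      using open_contains_cbox[OF U(1,3)] by metis
    have "AE p in lborel. p \<in> box l r \<longrightarrow> F p = 0"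
      using represented_by_locally_integrable[OF rep]
      by (rule AE_eq_0_if_box_integrals_eq_0)
        (rule integral_over_box_eq_0[OF rep U(2)], use lr(1) in blast)
    then show "p \<in> \<Union>\<B>" using lr(2) unfolding \<B>_def by blast
  qed
  ultimately show ?thesis
    using \<B>'(3) by (auto elim!: eventually_mono)
qed

lemma closed_dist_support: "closed (dist_support u)"
  unfolding dist_support_def by (intro closed_Compl open_Union) auto

section \<open>Square roots and square functions in the extended reals\<close>

lemma ennreal_power2_le_imp_le:
  fixes x y :: ennreal
  assumes "x\<^sup>2 \<le> y\<^sup>2"
  shows "x \<le> y"
  using assms
proof (cases x; cases y)
  fix a b :: real
  assume "x = ennreal a" "0 \<le> a" "y = ennreal b" "0 \<le> b"
  then show "x \<le> y"
    using assms power2_le_imp_le[of a b] by (simp add: ennreal_power)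
qed (use assms in \<open>auto simp: top_unique power2_eq_square ennreal_mult_eq_top_iff\<close>)

lemma ennreal_sqrt_power2: "(ennreal_sqrt x)\<^sup>2 = x"
  by (cases x) (auto simp: ennreal_sqrt_def power2_eq_square ennreal_mult_eq_top_iff simp flip: ennreal_mult)

lemma ennreal_sqrt_of_power2: "ennreal_sqrt (x\<^sup>2) = x"
  by (rule antisym; rule ennreal_power2_le_imp_le) (simp_all add: ennreal_sqrt_power2)

lemma ennreal_sqrt_mono: "x \<le> y \<Longrightarrow> ennreal_sqrt x \<le> ennreal_sqrt y"
  by (rule ennreal_power2_le_imp_le) (simp add: ennreal_sqrt_power2)

text \<open>Minkowski's inequality for countably many functions: expand the square and apply Cauchy-Schwarz
  to every cross term.\<close>

lemma nn_integral_suminf_square_le: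
  fixes u :: "nat \<Rightarrow> 'a \<Rightarrow> ennreal"
  assumes [measurable]: "\<And>n. u n \<in> borel_measurable M"
    and w: "\<And>n. (\<integral>\<^sup>+x. (u n x)\<^sup>2 \<partial>M) \<le> (w n)\<^sup>2"
  shows "(\<integral>\<^sup>+x. (\<Sum>n. u n x)\<^sup>2 \<partial>M) \<le> (\<Sum>n. w n)\<^sup>2"
proof -
  have cross: "(\<integral>\<^sup>+x. u n x * u m x \<partial>M) \<le> w n * w m" for n m
  proof (rule ennreal_power2_le_imp_le)
    have "(\<integral>\<^sup>+x. u n x * u m x \<partial>M)\<^sup>2 \<le> (\<integral>\<^sup>+x. (u n x)\<^sup>2 \<partial>M) * (\<integral>\<^sup>+x. (u m x)\<^sup>2 \<partial>M)"
      by (rule Cauchy_Schwarz_nn_integral) measurable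
    also have "\<dots> \<le> (w n)\<^sup>2 * (w m)\<^sup>2" by (intro mult_mono w) auto
    finally show "(\<integral>\<^sup>+x. u n x * u m x \<partial>M)\<^sup>2 \<le> (w n * w m)\<^sup>2" by (simp add: power_mult_distrib)
  qed
  have "(\<integral>\<^sup>+x. (\<Sum>n. u n x)\<^sup>2 \<partial>M) = (\<integral>\<^sup>+x. (\<Sum>n. \<Sum>m. u n x * u m x) \<partial>M)"
    by (simp add: power2_eq_square)
  also have "\<dots> = (\<Sum>n. \<Sum>m. \<integral>\<^sup>+x. u n x * u m x \<partial>M)"
    by (simp add: nn_integral_suminf del: ennreal_suminf_cmult ennreal_suminf_multc)
  also have "\<dots> \<le> (\<Sum>n. \<Sum>m. w n * w m)"
    by (intro suminf_le cross summableI)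
  also have "\<dots> = (\<Sum>n. w n)\<^sup>2" by (simp add: power2_eq_square)
  finally show ?thesis .
qed

section \<open>The resonance function\<close>

text \<open>If two modes have frequencies \<open>y\<close> and \<open>\<xi> - y\<close>, their modulations add up to the resonance
  function minus a quantity that depends only on the total time frequency and on \<open>\<xi>\<close>; see
  \<open>sum_of_modulations\<close> below.\<close>

definition resonance :: "real \<Rightarrow> real \<Rightarrow> real"
  where "resonance \<xi> y = 3 * \<xi> * (y * (\<xi> - y)) + \<xi> / (y * (\<xi> - y))"

text \<open>The information on the frequencies that the estimates use. The middle condition is the upper
  bound for \<open>Y = (\<xi>1 + \<xi>2)\<^sup>2 \<xi>1 \<xi>2\<close> contained in \<open>\<bar>1 - 4 / (3 Y)\<bar> \<le> 1 / 2\<close>.\<close>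

definition resonant_pair :: "real \<Rightarrow> real \<Rightarrow> real \<Rightarrow> bool"
  where "resonant_pair \<kappa> \<xi>1 \<xi>2 \<longleftrightarrow>
    \<xi>1 * \<xi>2 > 0 \<and> (\<xi>1 + \<xi>2)\<^sup>2 * (\<xi>1 * \<xi>2) \<le> 8 / 3 \<and> \<bar>\<xi>1 - \<xi>2\<bar> \<ge> \<kappa>"

lemma sum_of_modulations:
  fixes \<xi>1 \<xi>2 \<tau>1 \<tau>2 :: real
  assumes "\<xi>1 \<noteq> 0" "\<xi>2 \<noteq> 0"
  shows "(\<tau>1 - \<xi>1 ^ 3 + 1 / \<xi>1) + (\<tau>2 - \<xi>2 ^ 3 + 1 / \<xi>2) =
    resonance (\<xi>1 + \<xi>2) \<xi>1 - ((\<xi>1 + \<xi>2) ^ 3 - (\<tau>1 + \<tau>2))"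
proof -
  have "1 / \<xi>1 + 1 / \<xi>2 = (\<xi>1 + \<xi>2) / (\<xi>1 * \<xi>2)" using assms by (simp add: field_simps)
  moreover have "3 * (\<xi>1 + \<xi>2) * (\<xi>1 * \<xi>2) = (\<xi>1 + \<xi>2) ^ 3 - \<xi>1 ^ 3 - \<xi>2 ^ 3" by algebra
  ultimately show ?thesis unfolding resonance_def by simp
qed

lemma resonant_pair_sum_ge:
  assumes "resonant_pair \<kappa> \<xi>1 \<xi>2" shows "\<bar>\<xi>1 + \<xi>2\<bar> \<ge> \<kappa>"
  using assms unfolding resonant_pair_def zero_less_mult_iff by linarith

text \<open>With \<open>x = \<xi>1 \<xi>2\<close> one has \<open>(\<xi>1 + \<xi>2)\<^sup>2 = (\<xi>1 - \<xi>2)\<^sup>2 + 4 x \<ge> 4 + 4 x\<close>, so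
  \<open>x \<ge> 1 / 2\<close> would make \<open>(\<xi>1 + \<xi>2)\<^sup>2 x\<close> at least 3.\<close>

lemma resonant_pair_product_less:
  assumes "resonant_pair \<kappa> \<xi>1 \<xi>2" "\<kappa> \<ge> 2"
  shows "\<xi>1 * \<xi>2 < 1 / 2"
proof (rule ccontr)
  assume "\<not> \<xi>1 * \<xi>2 < 1 / 2"
  then have x: "\<xi>1 * \<xi>2 \<ge> 1 / 2" by simp
  have "2\<^sup>2 \<le> \<bar>\<xi>1 - \<xi>2\<bar>\<^sup>2" using assms unfolding resonant_pair_def by (intro power_mono) auto
  then have "(\<xi>1 + \<xi>2)\<^sup>2 \<ge> 4 + 4 * (\<xi>1 * \<xi>2)" by (simp add: power2_eq_square algebra_simps)
  then have "(\<xi>1 + \<xi>2)\<^sup>2 \<ge> 6" using x by linarith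
  then have "6 * (1 / 2) \<le> (\<xi>1 + \<xi>2)\<^sup>2 * (\<xi>1 * \<xi>2)" using x by (intro mult_mono) auto
  then show False using assms unfolding resonant_pair_def by linarith
qed

text \<open>As a function of \<open>a = y (\<xi> - y)\<close> the resonance function is \<open>3 \<xi> a + \<xi> / a\<close>, with
  difference quotient \<open>\<xi> (3 - 1 / (a b))\<close>. Products of resonant pairs are below \<open>1 / 2\<close>,
  so \<open>1 / (a b)\<close> exceeds 4 and the second term dominates. Finally
  \<open>a - b = (y - z) (\<xi> - y - z)\<close>, and the last factor is at least \<open>\<kappa>\<close> in size as long as \<open>y\<close>
  and \<open>z\<close> lie on the same side of \<open>\<xi> / 2\<close>. Working with difference quotients rather than
  derivatives avoids any discussion of the shape of the set of admissible \<open>y\<close>.\<close>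

lemma resonance_expanding:
  assumes y: "resonant_pair \<kappa> y (\<xi> - y)" and z: "resonant_pair \<kappa> z (\<xi> - z)" and \<kappa>: "\<kappa> \<ge> 2"
    and side: "(2 * y - \<xi>) * (2 * z - \<xi>) > 0"
  shows "\<bar>\<xi>\<bar> * \<kappa> * \<bar>y - z\<bar> \<le> \<bar>resonance \<xi> y - resonance \<xi> z\<bar>"
proof -
  define a where "a = y * (\<xi> - y)"
  define b where "b = z * (\<xi> - z)"
  have ab: "0 < a" "a < 1 / 2" "0 < b" "b < 1 / 2"
    using resonant_pair_product_less[OF y \<kappa>] resonant_pair_product_less[OF z \<kappa>] y z
    unfolding resonant_pair_def a_def b_def by auto
  have diff: "resonance \<xi> y - resonance \<xi> z = \<xi> * (a - b) * (3 - 1 / (a * b))"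
    using ab unfolding resonance_def a_def[symmetric] b_def[symmetric] by (simp add: field_simps)
  have "a * b \<le> 1 / 2 * (1 / 2)" using ab by (intro mult_mono) auto
  then have "1 / (a * b) \<ge> 4" using ab by (simp add: field_simps)
  then have slope: "\<bar>3 - 1 / (a * b)\<bar> \<ge> 1" by linarith
  have "\<bar>2 * y - \<xi>\<bar> \<ge> \<kappa>" "\<bar>2 * z - \<xi>\<bar> \<ge> \<kappa>"
    using y z unfolding resonant_pair_def by (auto simp: algebra_simps)
  then have "2 * \<kappa> \<le> \<bar>(2 * y - \<xi>) + (2 * z - \<xi>)\<bar>"
    using side by (auto simp: zero_less_mult_iff)
  then have "\<kappa> * \<bar>y - z\<bar> \<le> \<bar>y + z - \<xi>\<bar> * \<bar>y - z\<bar>" by (intro mult_right_mono) auto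
  also have "\<dots> = \<bar>a - b\<bar>"
    unfolding abs_mult[symmetric] abs_minus_commute[of a] by (simp add: a_def b_def algebra_simps)
  finally have "\<bar>\<xi>\<bar> * (\<kappa> * \<bar>y - z\<bar>) \<le> \<bar>\<xi>\<bar> * \<bar>a - b\<bar>" by (intro mult_left_mono) auto
  also have "\<dots> \<le> \<bar>\<xi>\<bar> * \<bar>a - b\<bar> * \<bar>3 - 1 / (a * b)\<bar>"
    using mult_left_mono[OF slope, of "\<bar>\<xi>\<bar> * \<bar>a - b\<bar>"] by simp
  finally show ?thesis unfolding diff by (simp add: abs_mult mult.assoc)
qed

lemma bounded_diameter_cover:
  fixes T :: "real set"
  assumes diam: "\<forall>y\<in>T. \<forall>z\<in>T. \<bar>y - z\<bar> \<le> D" and D: "D \<ge> 0"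
  shows "\<exists>S\<in>sets borel. T \<subseteq> S \<and> emeasure lborel S \<le> ennreal (2 * D)"
proof (cases "T = {}")
  case False
  then obtain z where z: "z \<in> T" by blast
  have "T \<subseteq> {z - D..z + D}"
  proof
    fix y assume "y \<in> T"
    then have "\<bar>y - z\<bar> \<le> D" using diam z by blast
    then show "y \<in> {z - D..z + D}" by (simp add: abs_le_iff)
  qed
  moreover have "emeasure lborel {z - D..z + D} \<le> ennreal (2 * D)" using D by simp
  moreover have "{z - D..z + D} \<in> sets borel" by simp
  ultimately show ?thesis by blast
qed (auto intro!: bexI[of _ "{}"])

text \<open>The part of the set on either side of \<open>\<xi> / 2\<close> has diameter at most
  \<open>2 L / (\<bar>\<xi>\<bar> \<kappa>)\<close> and is covered by an interval of twice that length. A measurable cover is used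
  because it saves showing that the set itself is measurable.\<close>

lemma resonance_sublevel_cover:
  assumes \<kappa>: "\<kappa> \<ge> 2" and \<xi>: "\<xi> \<noteq> 0" and L: "L \<ge> 0"
  obtains S where "S \<in> sets borel"
    "{y. resonant_pair \<kappa> y (\<xi> - y) \<and> \<bar>resonance \<xi> y - c\<bar> \<le> L} \<subseteq> S"
    "emeasure lborel S \<le> ennreal (8 * L / (\<bar>\<xi>\<bar> * \<kappa>))"
proof -
  define T where "T = {y. resonant_pair \<kappa> y (\<xi> - y) \<and> \<bar>resonance \<xi> y - c\<bar> \<le> L}"
  define D where "D = 2 * L / (\<bar>\<xi>\<bar> * \<kappa>)"
  have D: "D \<ge> 0" using \<kappa> L by (simp add: D_def)
  have diam: "\<bar>y - z\<bar> \<le> D" if "y \<in> T" "z \<in> T" "(2 * y - \<xi>) * (2 * z - \<xi>) > 0" for y z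
  proof -
    have "\<bar>\<xi>\<bar> * \<kappa> * \<bar>y - z\<bar> \<le> \<bar>resonance \<xi> y - resonance \<xi> z\<bar>"
      using that resonance_expanding[OF _ _ \<kappa>] unfolding T_def by blast
    also have "\<dots> \<le> 2 * L" using that unfolding T_def by auto
    finally show ?thesis unfolding D_def using \<xi> \<kappa> by (simp add: field_simps)
  qed
  have "\<forall>y\<in>T \<inter> {y. 2 * y - \<xi> > 0}. \<forall>z\<in>T \<inter> {y. 2 * y - \<xi> > 0}. \<bar>y - z\<bar> \<le> D"
    by (intro ballI diam mult_pos_pos) auto
  from bounded_diameter_cover[OF this D]
  obtain S1 where S1: "S1 \<in> sets borel" "T \<inter> {y. 2 * y - \<xi> > 0} \<subseteq> S1"
      "emeasure lborel S1 \<le> ennreal (2 * D)"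
    by (elim bexE conjE)
  have "\<forall>y\<in>T \<inter> {y. 2 * y - \<xi> < 0}. \<forall>z\<in>T \<inter> {y. 2 * y - \<xi> < 0}. \<bar>y - z\<bar> \<le> D"
    by (intro ballI diam mult_neg_neg) auto
  from bounded_diameter_cover[OF this D]
  obtain S2 where S2: "S2 \<in> sets borel" "T \<inter> {y. 2 * y - \<xi> < 0} \<subseteq> S2"
      "emeasure lborel S2 \<le> ennreal (2 * D)"
    by (elim bexE conjE)
  \<comment> \<open>The midpoint is excluded by the frequency separation.\<close>
  have off: "2 * y - \<xi> \<noteq> 0" if "y \<in> T" for y
    using that \<kappa> unfolding T_def resonant_pair_def by auto
  show ?thesis
  proof (rule that[of "S1 \<union> S2"])
    show "S1 \<union> S2 \<in> sets borel" using S1 S2 by auto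
    show "{y. resonant_pair \<kappa> y (\<xi> - y) \<and> \<bar>resonance \<xi> y - c\<bar> \<le> L} \<subseteq> S1 \<union> S2"
      unfolding T_def[symmetric] using S1(2) S2(2) off by (auto simp: neq_iff)
    have "emeasure lborel (S1 \<union> S2) \<le> emeasure lborel S1 + emeasure lborel S2"
      using S1 S2 by (intro emeasure_subadditive) auto
    also have "\<dots> \<le> ennreal (2 * D) + ennreal (2 * D)" by (intro add_mono S1 S2)
    also have "\<dots> = ennreal (2 * D + 2 * D)" using D by (intro ennreal_plus[symmetric]) auto
    also have "2 * D + 2 * D = 8 * L / (\<bar>\<xi>\<bar> * \<kappa>)" by (simp add: D_def)
    finally show "emeasure lborel (S1 \<union> S2) \<le> ennreal (8 * L / (\<bar>\<xi>\<bar> * \<kappa>))" .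
  qed
qed

section \<open>Bilinear estimate for dyadic pieces\<close>

lemma measurable_fst_plane [measurable]: "fst \<in> borel_measurable (borel :: plane measure)"
  and measurable_snd_plane [measurable]: "snd \<in> borel_measurable (borel :: plane measure)"
  by (simp_all add: borel_prod[symmetric])

lemma modulation_measurable [measurable]: "modulation \<in> borel_measurable borel"
  unfolding modulation_def bracket_def case_prod_beta' by measurable

lemma B_set_measurable [measurable]: "B_set k \<in> sets borel"
  unfolding B_set_def by measurable

lemma emeasure_strip_le:
  fixes c :: "real \<Rightarrow> real"
  assumes [measurable]: "S \<in> sets borel" "c \<in> borel_measurable borel" and r: "r \<ge> 0"
  shows "{p. snd p \<in> S \<and> \<bar>fst p - c (snd p)\<bar> \<le> r} \<in> sets borel"
    and "emeasure lborel {p. snd p \<in> S \<and> \<bar>fst p - c (snd p)\<bar> \<le> r} \<le> ennreal (2 * r) * emeasure lborel S"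
proof -
  let ?E = "{p. snd p \<in> S \<and> \<bar>fst p - c (snd p)\<bar> \<le> r}"
  show E[measurable]: "?E \<in> sets borel" by measurable
  have "emeasure lborel ?E = (\<integral>\<^sup>+p. indicator ?E p \<partial>(lborel \<Otimes>\<^sub>M lborel))"
    by (simp add: lborel_prod)
  also have "\<dots> = (\<integral>\<^sup>+y. \<integral>\<^sup>+x. indicator ?E (x, y) \<partial>lborel \<partial>lborel)"
    by (subst lborel_pair.nn_integral_snd) (simp_all add: lborel_prod)
  also have "\<dots> = (\<integral>\<^sup>+y. indicator S y * ennreal (2 * r) \<partial>lborel)"
  proof (intro nn_integral_cong)
    fix y
    have "(\<integral>\<^sup>+x. indicator ?E (x, y) \<partial>lborel) =
        (\<integral>\<^sup>+x. indicator S y * indicator {c y - r..c y + r} x \<partial>lborel)"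
      by (intro nn_integral_cong) (auto simp: indicator_def abs_le_iff)
    also have "\<dots> = indicator S y * ennreal (2 * r)"
      using r by (simp add: nn_integral_cmult)
    finally show "(\<integral>\<^sup>+x. indicator ?E (x, y) \<partial>lborel) = indicator S y * ennreal (2 * r)" .
  qed
  also have "\<dots> = ennreal (2 * r) * emeasure lborel S"
    by (simp add: nn_integral_multc mult.commute)
  finally show "emeasure lborel ?E \<le> ennreal (2 * r) * emeasure lborel S" by simp
qed

text \<open>The points \<open>q\<close> that contribute to the convolution at \<open>p\<close> when the two factors have
  modulations of size \<open>2 ^ k1\<close> and \<open>2 ^ k2\<close>.\<close>

definition interaction_set :: "real \<Rightarrow> nat \<Rightarrow> nat \<Rightarrow> plane \<Rightarrow> plane set"
  where "interaction_set \<kappa> k1 k2 p =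
    {q. q \<in> B_set k1 \<and> p - q \<in> B_set k2 \<and> resonant_pair \<kappa> (snd q) (snd p - snd q)}"

text \<open>For a fixed frequency, the smaller modulation confines the time frequency to an interval of
  length \<open>4 * 2 ^ min k1 k2\<close>. The sum of the modulations is at most \<open>4 * 2 ^ max k1 k2\<close>, so by
  the identity for the resonance function the frequency lies in a sublevel set of measure at most
  \<open>32 * 2 ^ max k1 k2 / (\<bar>\<xi>\<bar> \<kappa>)\<close>.\<close>

lemma interaction_set_cover:
  assumes \<kappa>: "\<kappa> \<ge> 2" and "snd p \<noteq> 0"
  obtains E where "E \<in> sets borel" "interaction_set \<kappa> k1 k2 p \<subseteq> E"
    "emeasure lborel E \<le> ennreal (128 * 2 ^ k1 * 2 ^ k2 / (\<bar>snd p\<bar> * \<kappa>))"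
proof -
  define \<tau> where "\<tau> = fst p"
  define \<xi> where "\<xi> = snd p"
  define w where "w y = y ^ 3 - 1 / y" for y :: real
  have w[measurable]: "w \<in> borel_measurable borel" unfolding w_def by measurable
  define M where "M = max k1 k2"
  define m where "m = min k1 k2"
  \<comment> \<open>The centre of the time interval comes from whichever factor has the smaller modulation.\<close>
  define c where "c y = (if k1 \<le> k2 then w y else \<tau> - w (\<xi> - y))" for y
  have c[measurable]: "c \<in> borel_measurable borel" unfolding c_def by measurable
  obtain S where S: "S \<in> sets borel"
    "{y. resonant_pair \<kappa> y (\<xi> - y) \<and> \<bar>resonance \<xi> y - (\<xi> ^ 3 - \<tau>)\<bar> \<le> 4 * 2 ^ M} \<subseteq> S"
    "emeasure lborel S \<le> ennreal (8 * (4 * 2 ^ M) / (\<bar>\<xi>\<bar> * \<kappa>))"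
    by (rule resonance_sublevel_cover[OF \<kappa>, of \<xi> "4 * 2 ^ M" "\<xi> ^ 3 - \<tau>"])
      (use \<open>snd p \<noteq> 0\<close> in \<open>auto simp: \<xi>_def\<close>)
  define E where "E = {q. snd q \<in> S \<and> \<bar>fst q - c (snd q)\<bar> \<le> 2 * 2 ^ m}"
  show ?thesis
  proof (rule that)
    show "E \<in> sets borel"
      unfolding E_def by (rule emeasure_strip_le(1)) (use S in auto)
    show "interaction_set \<kappa> k1 k2 p \<subseteq> E"
    proof
      fix q assume "q \<in> interaction_set \<kappa> k1 k2 p"
      then have q: "q \<in> B_set k1" "p - q \<in> B_set k2" and res: "resonant_pair \<kappa> (snd q) (\<xi> - snd q)"
        unfolding interaction_set_def \<xi>_def by auto
      have nz: "snd q \<noteq> 0" "\<xi> - snd q \<noteq> 0"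
        using res unfolding resonant_pair_def by auto
      have m1: "\<bar>fst q - snd q ^ 3 + 1 / snd q\<bar> \<le> 2 * 2 ^ k1"
        using q(1) by (simp add: B_set_def modulation_def bracket_def case_prod_beta')
      have m2: "\<bar>(\<tau> - fst q) - (\<xi> - snd q) ^ 3 + 1 / (\<xi> - snd q)\<bar> \<le> 2 * 2 ^ k2"
        using q(2) by (simp add: B_set_def modulation_def bracket_def case_prod_beta' \<tau>_def \<xi>_def)
      have le: "(2::real) ^ k1 \<le> 2 ^ M" "(2::real) ^ k2 \<le> 2 ^ M"
        by (simp_all add: M_def)
      have total: "snd q + (\<xi> - snd q) = \<xi>" "fst q + (\<tau> - fst q) = \<tau>" by auto
      have "\<bar>resonance \<xi> (snd q) - (\<xi> ^ 3 - \<tau>)\<bar> \<le> 4 * 2 ^ M"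
        using sum_of_modulations[OF nz, of "fst q" "\<tau> - fst q", unfolded total] m1 m2 le
        by linarith
      then have "snd q \<in> S" using S(2) res by auto
      moreover have "\<bar>fst q - c (snd q)\<bar> \<le> 2 * 2 ^ m"
        using m1 m2 by (cases "k1 \<le> k2") (auto simp: c_def w_def m_def)
      ultimately show "q \<in> E" by (simp add: E_def)
    qed
    have "emeasure lborel E \<le> ennreal (2 * (2 * 2 ^ m)) * emeasure lborel S"
      unfolding E_def by (rule emeasure_strip_le(2)) (use S in auto)
    also have "\<dots> \<le> ennreal (2 * (2 * 2 ^ m)) * ennreal (8 * (4 * 2 ^ M) / (\<bar>\<xi>\<bar> * \<kappa>))"
      using S by (intro mult_left_mono) auto
    also have "\<dots> = ennreal (128 * (2 ^ m * 2 ^ M) / (\<bar>\<xi>\<bar> * \<kappa>))"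
      using \<kappa> by (subst ennreal_mult[symmetric]) (auto simp: mult_ac)
    also have "(2::real) ^ m * 2 ^ M = 2 ^ k1 * 2 ^ k2"
      unfolding m_def M_def by (simp add: min_def max_def)
    finally show "emeasure lborel E \<le> ennreal (128 * 2 ^ k1 * 2 ^ k2 / (\<bar>snd p\<bar> * \<kappa>))"
      by (simp add: \<xi>_def mult.assoc)
  qed
qed

lemma nn_integral_convolution:
  fixes \<phi> \<gamma> :: "plane \<Rightarrow> ennreal"
  assumes [measurable]: "\<phi> \<in> borel_measurable borel" "\<gamma> \<in> borel_measurable borel"
  shows "(\<integral>\<^sup>+p. \<integral>\<^sup>+q. \<phi> q * \<gamma> (p - q) \<partial>lborel \<partial>lborel) =
    (\<integral>\<^sup>+q. \<phi> q \<partial>lborel) * (\<integral>\<^sup>+p. \<gamma> p \<partial>lborel)"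
proof -
  have shift: "(\<integral>\<^sup>+p. \<gamma> (p - q) \<partial>lborel) = (\<integral>\<^sup>+p. \<gamma> p \<partial>lborel)" for q
  proof -
    have "(\<integral>\<^sup>+p. \<gamma> p \<partial>lborel) = (\<integral>\<^sup>+p. \<gamma> p \<partial>distr lborel borel ((+) (- q)))"
      by (simp add: lborel_distr_plus)
    also have "\<dots> = (\<integral>\<^sup>+p. \<gamma> (p - q) \<partial>lborel)"
      by (subst nn_integral_distr) (simp_all add: algebra_simps)
    finally show ?thesis ..
  qed
  have "(\<integral>\<^sup>+p. \<integral>\<^sup>+q. \<phi> q * \<gamma> (p - q) \<partial>lborel \<partial>lborel) =
      (\<integral>\<^sup>+q. \<integral>\<^sup>+p. \<phi> q * \<gamma> (p - q) \<partial>lborel \<partial>lborel)"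
    by (rule lborel_pair.Fubini'[symmetric]) measurable
  also have "\<dots> = (\<integral>\<^sup>+q. \<phi> q * (\<integral>\<^sup>+p. \<gamma> p \<partial>lborel) \<partial>lborel)"
    by (simp add: nn_integral_cmult shift)
  finally show ?thesis by (simp add: nn_integral_multc)
qed

text \<open>Cauchy-Schwarz on the interaction set: the factor \<open>\<bar>\<xi>\<bar>\<close> in the weight cancels the one in
  the denominator of the measure bound.\<close>

lemma dyadic_piece_estimate:
  fixes \<phi> \<gamma> :: "plane \<Rightarrow> ennreal"
  assumes [measurable]: "\<phi> \<in> borel_measurable borel" "\<gamma> \<in> borel_measurable borel"
    and \<kappa>: "\<kappa> \<ge> 2"
    and supp: "\<And>p q. \<phi> q * \<gamma> (p - q) \<noteq> 0 \<Longrightarrow> q \<in> interaction_set \<kappa> k1 k2 p"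
  shows "(\<integral>\<^sup>+p. ennreal \<bar>snd p\<bar> * (\<integral>\<^sup>+q. \<phi> q * \<gamma> (p - q) \<partial>lborel)\<^sup>2 \<partial>lborel)
    \<le> ennreal (128 * 2 ^ k1 * 2 ^ k2 / \<kappa>) *
        ((\<integral>\<^sup>+q. (\<phi> q)\<^sup>2 \<partial>lborel) * (\<integral>\<^sup>+q. (\<gamma> q)\<^sup>2 \<partial>lborel))"
proof -
  let ?c = "128 * 2 ^ k1 * 2 ^ k2 / \<kappa>"
  have "ennreal \<bar>snd p\<bar> * (\<integral>\<^sup>+q. \<phi> q * \<gamma> (p - q) \<partial>lborel)\<^sup>2
      \<le> ennreal ?c * (\<integral>\<^sup>+q. (\<phi> q)\<^sup>2 * (\<gamma> (p - q))\<^sup>2 \<partial>lborel)" for p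
  proof (cases "snd p = 0")
    case False
    obtain E where E[measurable]: "E \<in> sets borel" and sub: "interaction_set \<kappa> k1 k2 p \<subseteq> E"
      and meas: "emeasure lborel E \<le> ennreal (128 * 2 ^ k1 * 2 ^ k2 / (\<bar>snd p\<bar> * \<kappa>))"
      using interaction_set_cover[OF \<kappa> False] .
    have "(\<integral>\<^sup>+q. \<phi> q * \<gamma> (p - q) \<partial>lborel) = (\<integral>\<^sup>+q. indicator E q * (\<phi> q * \<gamma> (p - q)) \<partial>lborel)"
    proof (intro nn_integral_cong)
      fix q show "\<phi> q * \<gamma> (p - q) = indicator E q * (\<phi> q * \<gamma> (p - q))"
        using supp[of q p] sub by (cases "q \<in> E") auto
    qed
    then have "(\<integral>\<^sup>+q. \<phi> q * \<gamma> (p - q) \<partial>lborel)\<^sup>2 \<le>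
        (\<integral>\<^sup>+q. (indicator E q)\<^sup>2 \<partial>lborel) * (\<integral>\<^sup>+q. (\<phi> q * \<gamma> (p - q))\<^sup>2 \<partial>lborel)"
      using Cauchy_Schwarz_nn_integral[of "indicator E" lborel "\<lambda>q. \<phi> q * \<gamma> (p - q)"] by simp
    also have "(\<integral>\<^sup>+q. (indicator E q)\<^sup>2 \<partial>lborel) = (\<integral>\<^sup>+q. indicator E q \<partial>lborel)"
      by (intro nn_integral_cong) (simp add: indicator_def)
    also have "\<dots> = emeasure lborel E" by simp
    finally have CS: "(\<integral>\<^sup>+q. \<phi> q * \<gamma> (p - q) \<partial>lborel)\<^sup>2 \<le>
        emeasure lborel E * (\<integral>\<^sup>+q. (\<phi> q)\<^sup>2 * (\<gamma> (p - q))\<^sup>2 \<partial>lborel)"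
      by (simp add: power_mult_distrib)
    have "ennreal \<bar>snd p\<bar> * (\<integral>\<^sup>+q. \<phi> q * \<gamma> (p - q) \<partial>lborel)\<^sup>2 \<le>
        ennreal \<bar>snd p\<bar> * (ennreal (128 * 2 ^ k1 * 2 ^ k2 / (\<bar>snd p\<bar> * \<kappa>)) *
          (\<integral>\<^sup>+q. (\<phi> q)\<^sup>2 * (\<gamma> (p - q))\<^sup>2 \<partial>lborel))"
      by (intro mult_left_mono order_trans[OF CS] mult_right_mono meas) auto
    also have "\<dots> = ennreal ?c * (\<integral>\<^sup>+q. (\<phi> q)\<^sup>2 * (\<gamma> (p - q))\<^sup>2 \<partial>lborel)"
      unfolding mult.assoc[symmetric] using \<kappa> False by (simp flip: ennreal_mult)
    finally show ?thesis .
  qed simp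
  then have "(\<integral>\<^sup>+p. ennreal \<bar>snd p\<bar> * (\<integral>\<^sup>+q. \<phi> q * \<gamma> (p - q) \<partial>lborel)\<^sup>2 \<partial>lborel)
      \<le> (\<integral>\<^sup>+p. ennreal ?c * (\<integral>\<^sup>+q. (\<phi> q)\<^sup>2 * (\<gamma> (p - q))\<^sup>2 \<partial>lborel) \<partial>lborel)"
    by (intro nn_integral_mono) 
  also have "\<dots> = ennreal ?c * (\<integral>\<^sup>+p. (\<integral>\<^sup>+q. (\<phi> q)\<^sup>2 * (\<gamma> (p - q))\<^sup>2 \<partial>lborel) \<partial>lborel)"
    by (rule nn_integral_cmult) measurable
  finally show ?thesis
    by (simp add: nn_integral_convolution[of "\<lambda>q. (\<phi> q)\<^sup>2" "\<lambda>q. (\<gamma> q)\<^sup>2"])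
qed

section \<open>Summation over the modulations\<close>

lemma modulation_ge_1: "modulation p \<ge> 1"
  by (simp add: modulation_def bracket_def case_prod_beta')

lemma B_set_partition: "\<exists>k. \<forall>j. p \<in> B_set j \<longleftrightarrow> j = k"
proof -
  obtain n where n: "modulation p < 2 ^ n" using real_arch_pow[of 2 "modulation p"] by auto
  define N where "N = (LEAST n. modulation p < 2 ^ n)"
  have N: "modulation p < 2 ^ N" unfolding N_def using n by (rule LeastI)
  then have "N \<noteq> 0" using modulation_ge_1[of p] by (metis linorder_not_less power_0)
  then obtain k where k: "N = Suc k" by (cases N) auto
  have "\<not> modulation p < 2 ^ k" using not_less_Least[of k "\<lambda>n. modulation p < 2 ^ n"] k N_def by simp
  then have mem: "2 ^ k \<le> modulation p" "modulation p < 2 ^ (k + 1)" using N k by auto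
  have "j = k" if "2 ^ j \<le> modulation p" "modulation p < 2 ^ (j + 1)" for j
  proof -
    have "(2::real) ^ j < 2 ^ (k + 1)" "(2::real) ^ k < 2 ^ (j + 1)" using that mem by linarith+
    then have "j < k + 1" "k < j + 1" by (simp_all only: power_strict_increasing_iff one_less_numeral_iff semiring_norm)
    then show ?thesis by simp
  qed
  then show ?thesis using mem unfolding B_set_def by blast
qed

lemma suminf_indicator_B_set: "(\<Sum>k. indicator (B_set k) p) = (1::ennreal)"
proof -
  obtain k where "\<forall>j. p \<in> B_set j \<longleftrightarrow> j = k" using B_set_partition by blast
  then have "(\<lambda>j. indicator (B_set j) p) = (\<lambda>j. if j = k then 1 else 0 :: ennreal)"
    by (auto simp: indicator_def)
  then show ?thesis using sums_single[of k "\<lambda>_. 1 :: ennreal"] by (simp add: sums_iff)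
qed

text \<open>The norm of \<open>X_hat_norm_fun 0 (1/2)\<close> for a function living on a single frequency annulus, with the
  weight replaced by its lower bound on each \<open>B_set k\<close>.\<close>

definition modulation_sum :: "(plane \<Rightarrow> complex) \<Rightarrow> ennreal"
  where "modulation_sum F = (\<Sum>k. ennreal (sqrt (2 ^ k)) * L2_norm_on (B_set k) F)"

text \<open>Decompose both factors according to their modulation, estimate each pair of pieces and sum with
  Minkowski's inequality. The convolution is supported where \<open>\<bar>\<xi>\<bar> \<ge> \<kappa> \<ge> 1\<close>, which is why every
  weight \<open>a \<le> 1 / 2\<close> is dominated by \<open>a = 1 / 2\<close>.\<close>

lemma convolution_L2_estimate:
  fixes F G :: "plane \<Rightarrow> complex"
  assumes [measurable]: "F \<in> borel_measurable borel" "G \<in> borel_measurable borel"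
    and \<kappa>: "\<kappa> \<ge> 2" and a: "a \<le> 1 / 2"
    and res: "\<And>p q. F q \<noteq> 0 \<Longrightarrow> G (p - q) \<noteq> 0 \<Longrightarrow> resonant_pair \<kappa> (snd q) (snd p - snd q)"
  shows "L2_norm_on UNIV (\<lambda>p. complex_of_real (\<bar>snd p\<bar> powr a) * (\<integral>q. F q * G (p - q) \<partial>lborel))
    \<le> ennreal (12 / sqrt \<kappa>) * modulation_sum F * modulation_sum G"
proof -
  define \<phi> where "\<phi> k q = indicator (B_set k) q * ennreal (norm (F q))" for k q
  define \<gamma> where "\<gamma> k q = indicator (B_set k) q * ennreal (norm (G q))" for k q
  have [measurable]: "\<phi> k \<in> borel_measurable borel" "\<gamma> k \<in> borel_measurable borel" for k
    unfolding \<phi>_def \<gamma>_def by measurable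
  define v where "v k = ennreal (sqrt (2 ^ k)) * L2_norm_on (B_set k) F" for k
  define w where "w k = ennreal (sqrt (2 ^ k)) * L2_norm_on (B_set k) G" for k
  have v: "(v k)\<^sup>2 = ennreal (2 ^ k) * (\<integral>\<^sup>+q. (\<phi> k q)\<^sup>2 \<partial>lborel)" for k
  proof -
    have "(\<integral>\<^sup>+q\<in>B_set k. ennreal ((norm (F q))\<^sup>2) \<partial>lborel) = (\<integral>\<^sup>+q. (\<phi> k q)\<^sup>2 \<partial>lborel)"
      by (intro nn_integral_cong) (auto simp: \<phi>_def indicator_def ennreal_power)
    then show ?thesis
      by (simp add: v_def L2_norm_on_def power_mult_distrib ennreal_sqrt_power2 ennreal_power)
  qed
  have w: "(w k)\<^sup>2 = ennreal (2 ^ k) * (\<integral>\<^sup>+q. (\<gamma> k q)\<^sup>2 \<partial>lborel)" for k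
  proof -
    have "(\<integral>\<^sup>+q\<in>B_set k. ennreal ((norm (G q))\<^sup>2) \<partial>lborel) = (\<integral>\<^sup>+q. (\<gamma> k q)\<^sup>2 \<partial>lborel)"
      by (intro nn_integral_cong) (auto simp: \<gamma>_def indicator_def ennreal_power)
    then show ?thesis
      by (simp add: w_def L2_norm_on_def power_mult_distrib ennreal_sqrt_power2 ennreal_power)
  qed
  \<comment> \<open>The piecewise bound has the constant 128; the next square 144 gives a rational root.\<close>
  define c where "c = ennreal (12 / sqrt \<kappa>)"
  have c: "c\<^sup>2 = ennreal (144 / \<kappa>)"
    using \<kappa> by (simp add: c_def ennreal_power power_divide)
  define u where "u k1 k2 p = ennreal (sqrt \<bar>snd p\<bar>) * (\<integral>\<^sup>+q. \<phi> k1 q * \<gamma> k2 (p - q) \<partial>lborel)" for k1 k2 p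
  have [measurable]: "u k1 k2 \<in> borel_measurable lborel" for k1 k2
    unfolding u_def by measurable
  have piece: "(\<integral>\<^sup>+p. (u k1 k2 p)\<^sup>2 \<partial>lborel) \<le> (c * v k1 * w k2)\<^sup>2" for k1 k2
  proof -
    have "(\<integral>\<^sup>+p. (u k1 k2 p)\<^sup>2 \<partial>lborel) =
        (\<integral>\<^sup>+p. ennreal \<bar>snd p\<bar> * (\<integral>\<^sup>+q. \<phi> k1 q * \<gamma> k2 (p - q) \<partial>lborel)\<^sup>2 \<partial>lborel)"
      by (simp add: u_def power_mult_distrib ennreal_power)
    also have "\<dots> \<le> ennreal (128 * 2 ^ k1 * 2 ^ k2 / \<kappa>) *
        ((\<integral>\<^sup>+q. (\<phi> k1 q)\<^sup>2 \<partial>lborel) * (\<integral>\<^sup>+q. (\<gamma> k2 q)\<^sup>2 \<partial>lborel))"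
    proof (rule dyadic_piece_estimate[OF _ _ \<kappa>])
      fix p q assume "\<phi> k1 q * \<gamma> k2 (p - q) \<noteq> 0"
      then have "q \<in> B_set k1" "F q \<noteq> 0" "p - q \<in> B_set k2" "G (p - q) \<noteq> 0"
        by (auto simp: \<phi>_def \<gamma>_def indicator_def split: if_splits)
      then show "q \<in> interaction_set \<kappa> k1 k2 p"
        using res by (simp add: interaction_set_def)
    qed measurable
    also have "\<dots> \<le> ennreal (144 / \<kappa> * 2 ^ k1 * 2 ^ k2) *
        ((\<integral>\<^sup>+q. (\<phi> k1 q)\<^sup>2 \<partial>lborel) * (\<integral>\<^sup>+q. (\<gamma> k2 q)\<^sup>2 \<partial>lborel))"
      using \<kappa> by (intro mult_right_mono ennreal_leI) (auto simp: field_simps)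
    also have "ennreal (144 / \<kappa> * 2 ^ k1 * 2 ^ k2) = ennreal (144 / \<kappa>) * ennreal (2 ^ k1) * ennreal (2 ^ k2)"
      using \<kappa> by (simp add: ennreal_mult del: times_divide_eq_left)
    also have "\<dots> * ((\<integral>\<^sup>+q. (\<phi> k1 q)\<^sup>2 \<partial>lborel) * (\<integral>\<^sup>+q. (\<gamma> k2 q)\<^sup>2 \<partial>lborel)) = (c * v k1 * w k2)\<^sup>2"
      unfolding power_mult_distrib v w c by (simp only: mult_ac)
    finally show ?thesis .
  qed
  have "(\<integral>\<^sup>+p. (\<Sum>k2. u k1 k2 p)\<^sup>2 \<partial>lborel) \<le> (\<Sum>k2. c * v k1 * w k2)\<^sup>2" for k1
    by (rule nn_integral_suminf_square_le[OF _ piece]) measurable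
  then have "(\<integral>\<^sup>+p. (\<Sum>k1. \<Sum>k2. u k1 k2 p)\<^sup>2 \<partial>lborel) \<le> (\<Sum>k1. \<Sum>k2. c * v k1 * w k2)\<^sup>2"
    by (rule nn_integral_suminf_square_le[rotated]) measurable
  also have "(\<Sum>k1. \<Sum>k2. c * v k1 * w k2) = c * modulation_sum F * modulation_sum G"
    by (simp add: modulation_sum_def v_def[symmetric] w_def[symmetric])
  finally have sum: "(\<integral>\<^sup>+p. (\<Sum>k1. \<Sum>k2. u k1 k2 p)\<^sup>2 \<partial>lborel) \<le> (c * modulation_sum F * modulation_sum G)\<^sup>2" .
  have u_sum: "(\<Sum>k1. \<Sum>k2. u k1 k2 p) =
      ennreal (sqrt \<bar>snd p\<bar>) * (\<integral>\<^sup>+q. ennreal (norm (F q * G (p - q))) \<partial>lborel)" for p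
  proof -
    have "(\<Sum>k1. \<Sum>k2. u k1 k2 p) =
        ennreal (sqrt \<bar>snd p\<bar>) * (\<integral>\<^sup>+q. (\<Sum>k1. \<Sum>k2. \<phi> k1 q * \<gamma> k2 (p - q)) \<partial>lborel)"
      by (simp add: u_def nn_integral_suminf del: ennreal_suminf_multc)
        (simp add: nn_integral_suminf[symmetric])
    moreover have "(\<Sum>k1. \<Sum>k2. \<phi> k1 q * \<gamma> k2 (p - q)) = ennreal (norm (F q * G (p - q)))" for q
      by (simp add: \<phi>_def \<gamma>_def suminf_indicator_B_set norm_mult ennreal_mult)
    ultimately show ?thesis by simp
  qed
  have pointwise: "ennreal ((norm (complex_of_real (\<bar>snd p\<bar> powr a) * (\<integral>q. F q * G (p - q) \<partial>lborel)))\<^sup>2)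
      \<le> (\<Sum>k1. \<Sum>k2. u k1 k2 p)\<^sup>2" for p
  proof -
    let ?I = "\<integral>q. F q * G (p - q) \<partial>lborel"
    have "ennreal (norm (complex_of_real (\<bar>snd p\<bar> powr a) * ?I)) \<le> (\<Sum>k1. \<Sum>k2. u k1 k2 p)"
    proof (cases "?I = 0")
      case False
      then have int: "integrable lborel (\<lambda>q. F q * G (p - q))"
        using not_integrable_integral_eq by blast
      obtain q where q: "F q * G (p - q) \<noteq> 0"
        using False by (metis (mono_tags, lifting) Bochner_Integration.integral_zero Bochner_Integration.integral_cong)
      then have "\<bar>snd p\<bar> \<ge> \<kappa>"
        using resonant_pair_sum_ge[OF res[of q p]] by simp
      then have "\<bar>snd p\<bar> powr a \<le> \<bar>snd p\<bar> powr (1 / 2)"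
        using \<kappa> a by (intro powr_mono) auto
      then have wt: "\<bar>snd p\<bar> powr a \<le> sqrt \<bar>snd p\<bar>" by (simp add: powr_half_sqrt)
      have "ennreal (norm (complex_of_real (\<bar>snd p\<bar> powr a) * ?I)) = ennreal (\<bar>snd p\<bar> powr a) * ennreal (norm ?I)"
        by (simp add: norm_mult ennreal_mult)
      also have "\<dots> \<le> ennreal (sqrt \<bar>snd p\<bar>) * (\<integral>\<^sup>+q. ennreal (norm (F q * G (p - q))) \<partial>lborel)"
        by (intro mult_mono ennreal_leI wt integral_norm_bound_ennreal int) auto
      finally show ?thesis unfolding u_sum .
    qed simp
    then show ?thesis
      unfolding ennreal_power[OF norm_ge_zero, symmetric] by (rule power_mono) simp
  qed
  have "L2_norm_on UNIV (\<lambda>p. complex_of_real (\<bar>snd p\<bar> powr a) * (\<integral>q. F q * G (p - q) \<partial>lborel))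
      \<le> ennreal_sqrt (\<integral>\<^sup>+p. (\<Sum>k1. \<Sum>k2. u k1 k2 p)\<^sup>2 \<partial>lborel)"
    unfolding L2_norm_on_def by (intro ennreal_sqrt_mono nn_integral_mono) (use pointwise in simp)
  also have "\<dots> \<le> ennreal_sqrt ((c * modulation_sum F * modulation_sum G)\<^sup>2)"
    by (rule ennreal_sqrt_mono[OF sum])
  finally show ?thesis by (simp only: ennreal_sqrt_of_power2 c_def)
qed

lemma modulation_sum_le_X_hat_norm_fun:
  assumes [measurable]: "F' \<in> borel_measurable borel"
    and F': "\<And>p. F' p \<noteq> 0 \<Longrightarrow> p \<in> A_set j \<and> F' p = F p"
  shows "modulation_sum F' \<le> X_hat_norm_fun 0 (1 / 2) F"
proof -
  define W where "W p = complex_of_real (bracket (snd p) powr 0 * modulation p powr (1 / 2)) * F p" for p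
  have W: "(norm (W p))\<^sup>2 = modulation p * (norm (F p))\<^sup>2" for p
  proof -
    have "bracket (snd p) \<noteq> 0" by (simp add: bracket_def add_nonneg_eq_0_iff)
    then show ?thesis
      using modulation_ge_1[of p]
      by (simp add: W_def norm_mult power_mult_distrib powr_half_sqrt)
  qed
  have "ennreal (sqrt (2 ^ k)) * L2_norm_on (B_set k) F' \<le> L2_norm_on (A_set j \<inter> B_set k) W" for k
  proof (rule ennreal_power2_le_imp_le)
    have "(ennreal (sqrt (2 ^ k)) * L2_norm_on (B_set k) F')\<^sup>2 =
        ennreal (2 ^ k) * (\<integral>\<^sup>+p\<in>B_set k. ennreal ((norm (F' p))\<^sup>2) \<partial>lborel)"
      by (simp add: L2_norm_on_def power_mult_distrib ennreal_sqrt_power2 ennreal_power)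
    also have "\<dots> = (\<integral>\<^sup>+p\<in>B_set k. ennreal (2 ^ k * (norm (F' p))\<^sup>2) \<partial>lborel)"
      by (subst nn_integral_cmult[symmetric]) (auto simp: ennreal_mult mult.assoc)
    also have "\<dots> \<le> (\<integral>\<^sup>+p\<in>A_set j \<inter> B_set k. ennreal ((norm (W p))\<^sup>2) \<partial>lborel)"
    proof (intro nn_integral_mono)
      fix p
      show "ennreal (2 ^ k * (norm (F' p))\<^sup>2) * indicator (B_set k) p
          \<le> ennreal ((norm (W p))\<^sup>2) * indicator (A_set j \<inter> B_set k) p"
      proof (cases "F' p \<noteq> 0 \<and> p \<in> B_set k")
        case True
        then have "2 ^ k \<le> modulation p" by (simp add: B_set_def)
        then show ?thesis
          using True F'[of p] by (simp add: W ennreal_leI mult_right_mono)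
      qed auto
    qed
    also have "\<dots> = (L2_norm_on (A_set j \<inter> B_set k) W)\<^sup>2"
      by (simp add: L2_norm_on_def ennreal_sqrt_power2)
    finally show "(ennreal (sqrt (2 ^ k)) * L2_norm_on (B_set k) F')\<^sup>2 \<le> (L2_norm_on (A_set j \<inter> B_set k) W)\<^sup>2" .
  qed
  then have "modulation_sum F' \<le> (\<Sum>k. L2_norm_on (A_set j \<inter> B_set k) W)"
    unfolding modulation_sum_def by (intro suminf_le summableI)
  then have "(modulation_sum F')\<^sup>2 \<le> (\<Sum>k. L2_norm_on (A_set j \<inter> B_set k) W)\<^sup>2"
    by (rule power_mono) simp
  also have "\<dots> \<le> (\<Sum>i. (\<Sum>k. L2_norm_on (A_set i \<inter> B_set k) W)\<^sup>2)"
    using sum_le_suminf[OF summableI, of "{j}" "\<lambda>i. (\<Sum>k. L2_norm_on (A_set i \<inter> B_set k) W)\<^sup>2"] by simp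
  finally have "ennreal_sqrt ((modulation_sum F')\<^sup>2)
      \<le> ennreal_sqrt (\<Sum>i. (\<Sum>k. L2_norm_on (A_set i \<inter> B_set k) W)\<^sup>2)"
    by (rule ennreal_sqrt_mono)
  then show ?thesis
    unfolding X_hat_norm_fun_def W_def[symmetric] by (simp only: ennreal_sqrt_of_power2)
qed

section \<open>From distributions to functions\<close>

lemma AE_reflect_plane:
  fixes p :: plane
  assumes "AE q in lborel. P q"
  shows "AE q in lborel. P (p - q)"
proof -
  have "distr lborel borel (\<lambda>q. p - q) = lborel"
    using lborel_affine[of "-1" p] by (simp add: density_1)
  then have "AE q in distr lborel borel (\<lambda>q. p - q). P q" by (rule ssubst) (rule assms)
  then show ?thesis by (rule AE_distrD[rotated]) measurable
qed

lemma AE_snd_neq_0: "AE p :: plane in lborel. snd p \<noteq> 0"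
proof -
  have "negligible {p :: plane. p \<bullet> (0, 1) = 0}"
    by (rule negligible_standard_hyperplane) (simp add: Basis_prod_def)
  then have "AE p :: plane in lebesgue. p \<notin> {p. p \<bullet> (0, 1) = 0}"
    by (intro AE_not_in) (simp add: negligible_iff_null_sets)
  then show ?thesis by (simp add: AE_completion_iff inner_prod_def)
qed

text \<open>A representative that vanishes off the support and on the null line \<open>\<xi> = 0\<close>, so that the
  hypotheses on the supports hold at each point where it is nonzero.\<close>

definition support_restriction :: "((plane \<Rightarrow> complex) \<Rightarrow> complex) \<Rightarrow> plane \<Rightarrow> complex"
  where "support_restriction u p = (if p \<in> dist_support u \<and> snd p \<noteq> 0 then dist_fun u p else 0)"

lemma
  assumes "X_hat_norm s b u < \<infinity>"
  shows support_restriction_measurable: "support_restriction u \<in> borel_measurable borel"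
    and support_restriction_AE_eq: "AE p in lborel. dist_fun u p = support_restriction u p"
    and dist_fun_measurable: "dist_fun u \<in> borel_measurable borel"
    and X_hat_norm_eq: "X_hat_norm s b u = X_hat_norm_fun s b (dist_fun u)"
proof -
  have ex: "\<exists>F. represented_by u F"
    using assms by (auto simp: X_hat_norm_def split: if_splits)
  then have rep: "represented_by u (dist_fun u)"
    unfolding dist_fun_def by (rule someI_ex)
  show meas[measurable]: "dist_fun u \<in> borel_measurable borel"
    using rep by (simp add: represented_by_def)
  have [measurable]: "dist_support u \<in> sets borel"
    using closed_dist_support by (rule borel_closed)
  show "support_restriction u \<in> borel_measurable borel"
    unfolding support_restriction_def[abs_def] by measurable
  show "AE p in lborel. dist_fun u p = support_restriction u p"
    using represented_by_AE_eq_0_off_support[OF rep] AE_snd_neq_0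
    by eventually_elim (auto simp: support_restriction_def)
  show "X_hat_norm s b u = X_hat_norm_fun s b (dist_fun u)"
    using ex by (simp add: X_hat_norm_def)
qed

lemma convol_eq_support_restriction:
  assumes f: "X_hat_norm s b f < \<infinity>" and g: "X_hat_norm s b g < \<infinity>"
  shows "convol f g p = (\<integral>q. support_restriction f q * support_restriction g (p - q) \<partial>lborel)"
proof -
  note [measurable] = support_restriction_measurable[OF f] support_restriction_measurable[OF g]
    dist_fun_measurable[OF f] dist_fun_measurable[OF g]
  show ?thesis
    unfolding convol_def
  proof (rule integral_cong_AE)
    show "AE q in lborel. dist_fun f q * dist_fun g (p - q) = support_restriction f q * support_restriction g (p - q)"
      using support_restriction_AE_eq[OF f] AE_reflect_plane[OF support_restriction_AE_eq[OF g], of p]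
      by eventually_elim simp
  qed measurable
qed

lemma weighted_convol_norm_le:
  assumes f: "X_hat_norm 0 (1 / 2) f < \<infinity>" and g: "X_hat_norm 0 (1 / 2) g < \<infinity>"
    and A: "dist_support f \<subseteq> A_set j1" "dist_support g \<subseteq> A_set j2"
    and \<kappa>: "\<kappa> \<ge> 2" and a: "a \<le> 1 / 2"
    and res: "\<And>p q. support_restriction f q \<noteq> 0 \<Longrightarrow> support_restriction g (p - q) \<noteq> 0 \<Longrightarrow>
      resonant_pair \<kappa> (snd q) (snd p - snd q)"
  shows "weighted_convol_norm a f g
    \<le> ennreal (12 / sqrt \<kappa>) * X_hat_norm 0 (1 / 2) f * X_hat_norm 0 (1 / 2) g"
proof -
  have "weighted_convol_norm a f g \<le> ennreal (12 / sqrt \<kappa>) *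
      modulation_sum (support_restriction f) * modulation_sum (support_restriction g)"
    unfolding weighted_convol_norm_def convol_eq_support_restriction[OF f g]
    by (intro convolution_L2_estimate support_restriction_measurable[OF f]
        support_restriction_measurable[OF g] \<kappa> a res)
  also have "\<dots> \<le> ennreal (12 / sqrt \<kappa>) * X_hat_norm 0 (1 / 2) f * X_hat_norm 0 (1 / 2) g"
    unfolding X_hat_norm_eq[OF f] X_hat_norm_eq[OF g]
    using A
    by (intro mult_mono order_refl
        modulation_sum_le_X_hat_norm_fun[OF support_restriction_measurable[OF f], of j1]
        modulation_sum_le_X_hat_norm_fun[OF support_restriction_measurable[OF g], of j2])
      (auto simp: support_restriction_def split: if_splits)
  finally show ?thesis .
qed

lemma support_pairs_resonant:
  assumes K: "ennreal \<kappa> \<le> freq_separation f g"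
    and q: "support_restriction f q \<noteq> 0" and r: "support_restriction g (p - q) \<noteq> 0"
    and sign: "\<forall>\<tau>1 \<xi>1 \<tau>2 \<xi>2 \<xi>. (\<tau>1, \<xi>1) \<in> dist_support f \<longrightarrow> (\<tau>2, \<xi>2) \<in> dist_support g \<longrightarrow>
         \<xi> = \<xi>1 + \<xi>2 \<longrightarrow>
         \<xi>1 * \<xi>2 \<ge> 0 \<and>
         (\<xi>\<^sup>2 * \<xi>1 * \<xi>2 \<noteq> 0 \<longrightarrow> \<bar>1 - 4 / (3 * \<xi>\<^sup>2 * \<xi>1 * \<xi>2)\<bar> \<le> 1/2)"
  shows "resonant_pair \<kappa> (snd q) (snd p - snd q)"
proof -
  define x where "x = snd q"
  define y where "y = snd p - snd q"
  have "(fst q, x) = q" "(fst (p - q), y) = p - q" by (simp_all add: x_def y_def prod_eq_iff)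
  then have mem: "(fst q, x) \<in> dist_support f" "(fst (p - q), y) \<in> dist_support g"
      and nz: "x \<noteq> 0" "y \<noteq> 0"
    using q r by (auto simp: support_restriction_def x_def y_def split: if_splits)
  have "x * y \<ge> 0" using sign mem by blast
  then have pos: "x * y > 0" using nz by (simp add: less_le)
  then have "x + y \<noteq> 0" by (auto simp: add_eq_0_iff zero_less_mult_iff)
  then have Y: "(x + y)\<^sup>2 * (x * y) > 0" using pos by simp
  have "(x + y)\<^sup>2 * x * y \<noteq> 0" using \<open>x + y \<noteq> 0\<close> nz by simp
  then have "\<bar>1 - 4 / (3 * (x + y)\<^sup>2 * x * y)\<bar> \<le> 1 / 2" using sign mem by blast
  then have "4 / (3 * ((x + y)\<^sup>2 * (x * y))) \<ge> 1 / 2" unfolding mult.assoc by linarith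
  then have "(x + y)\<^sup>2 * (x * y) \<le> 8 / 3" using Y by (simp add: field_simps)
  moreover have "freq_separation f g \<le> ennreal \<bar>x - y\<bar>"
    unfolding freq_separation_def using mem by (intro Inf_lower) blast
  then have "ennreal \<kappa> \<le> ennreal \<bar>x - y\<bar>" using K by (rule order_trans[rotated])
  then have "\<kappa> \<le> \<bar>x - y\<bar>" by simp
  ultimately show ?thesis
    using pos unfolding resonant_pair_def x_def y_def by simp
qed

theorem lemma2p2:
  shows "\<exists>C::real. C > 0 \<and>
    (\<forall>(j1::nat) (j2::nat) f g.
      tempered_distribution f \<longrightarrow> tempered_distribution g \<longrightarrow>
      X_hat_norm 0 (1/2) f < \<infinity> \<longrightarrow> X_hat_norm 0 (1/2) g < \<infinity> \<longrightarrow>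
      dist_support f \<subseteq> A_set j1 \<longrightarrow> dist_support g \<subseteq> A_set j2 \<longrightarrow>
      freq_separation f g \<ge> 2 \<longrightarrow>
      (\<forall>\<tau>1 \<xi>1 \<tau>2 \<xi>2 \<xi>. (\<tau>1, \<xi>1) \<in> dist_support f \<longrightarrow> (\<tau>2, \<xi>2) \<in> dist_support g \<longrightarrow>
         \<xi> = \<xi>1 + \<xi>2 \<longrightarrow>
         \<xi>1 * \<xi>2 \<ge> 0 \<and>
         (\<xi>\<^sup>2 * \<xi>1 * \<xi>2 \<noteq> 0 \<longrightarrow> \<bar>1 - 4 / (3 * \<xi>\<^sup>2 * \<xi>1 * \<xi>2)\<bar> \<le> 1/2)) \<longrightarrow>
      weighted_convol_norm (1/4) f g
        \<le> ennreal C * X_hat_norm 0 (1/2) f * X_hat_norm 0 (1/2) g \<and>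
      weighted_convol_norm (1/2) f g
        \<le> ennreal C * inverse (ennreal_sqrt (freq_separation f g))
            * X_hat_norm 0 (1/2) f * X_hat_norm 0 (1/2) g)"
proof (intro exI[of _ 12] conjI allI impI)
  fix j1 j2 :: nat and f g
  assume f: "X_hat_norm 0 (1/2) f < \<infinity>" and g: "X_hat_norm 0 (1/2) g < \<infinity>"
    and A: "dist_support f \<subseteq> A_set j1" "dist_support g \<subseteq> A_set j2"
    and K: "freq_separation f g \<ge> 2"
    and sign: "\<forall>\<tau>1 \<xi>1 \<tau>2 \<xi>2 \<xi>. (\<tau>1, \<xi>1) \<in> dist_support f \<longrightarrow> (\<tau>2, \<xi>2) \<in> dist_support g \<longrightarrow>
         \<xi> = \<xi>1 + \<xi>2 \<longrightarrow>
         \<xi>1 * \<xi>2 \<ge> 0 \<and>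
         (\<xi>\<^sup>2 * \<xi>1 * \<xi>2 \<noteq> 0 \<longrightarrow> \<bar>1 - 4 / (3 * \<xi>\<^sup>2 * \<xi>1 * \<xi>2)\<bar> \<le> 1/2)"
  have main: "weighted_convol_norm a f g
      \<le> ennreal (12 / sqrt \<kappa>) * X_hat_norm 0 (1/2) f * X_hat_norm 0 (1/2) g"
    if "\<kappa> \<ge> 2" "ennreal \<kappa> \<le> freq_separation f g" "a \<le> 1/2" for \<kappa> a
    using that by (intro weighted_convol_norm_le[OF f g A] support_pairs_resonant[OF _ _ _ sign]) auto
  have "ennreal 2 \<le> freq_separation f g" using K by simp
  from main[OF order_refl this, of "1/4"]
  have "weighted_convol_norm (1/4) f g
      \<le> ennreal (12 / sqrt 2) * X_hat_norm 0 (1/2) f * X_hat_norm 0 (1/2) g" by simp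
  also have "\<dots> \<le> ennreal 12 * X_hat_norm 0 (1/2) f * X_hat_norm 0 (1/2) g"
    by (intro mult_right_mono ennreal_leI) (auto simp: field_simps)
  finally show "weighted_convol_norm (1/4) f g
      \<le> ennreal 12 * X_hat_norm 0 (1/2) f * X_hat_norm 0 (1/2) g" .
  show "weighted_convol_norm (1/2) f g \<le> ennreal 12 * inverse (ennreal_sqrt (freq_separation f g))
      * X_hat_norm 0 (1/2) f * X_hat_norm 0 (1/2) g"
  proof (cases "freq_separation f g")
    case (real \<kappa>)
    then have \<kappa>: "\<kappa> \<ge> 2" using K by simp
    have "inverse (ennreal_sqrt (freq_separation f g)) = ennreal (1 / sqrt \<kappa>)"
      using real \<kappa> by (simp add: ennreal_sqrt_def inverse_ennreal inverse_eq_divide)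
    moreover have "ennreal 12 * ennreal (1 / sqrt \<kappa>) = ennreal (12 * (1 / sqrt \<kappa>))"
      using \<kappa> by (intro ennreal_mult[symmetric]) auto
    ultimately have "ennreal 12 * inverse (ennreal_sqrt (freq_separation f g)) = ennreal (12 / sqrt \<kappa>)"
      by simp
    then show ?thesis using main[OF \<kappa>, of "1/2"] real by simp
  next
    case top
    \<comment> \<open>An infinite separation means that there is no pair of points in the two supports.\<close>
    have zero: "support_restriction f q * support_restriction g (p - q) = 0" for p q
    proof (rule ccontr)
      assume "support_restriction f q * support_restriction g (p - q) \<noteq> 0"
      then have "resonant_pair (\<bar>snd q - (snd p - snd q)\<bar> + 1) (snd q) (snd p - snd q)"
        using top by (intro support_pairs_resonant[OF _ _ _ sign]) auto
      then show False by (simp add: resonant_pair_def)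
    qed
    have "weighted_convol_norm (1/2) f g = 0"
      unfolding weighted_convol_norm_def convol_eq_support_restriction[OF f g] zero
      by (simp add: L2_norm_on_def ennreal_sqrt_def)
    then show ?thesis by simp
  qed
qed simp

end
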